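(* (1) The lucky car set statistic $\mathrm{Lucky}$ is weakly shuffle-compatible on parking functions. (2) Let $\{Z_\delta\}_\delta$ be a binary shuffle basis of $\mathrm{QSym}$. The linear map on $\mathcal{A}^{\mathrm{PF}}_{\mathrm{Lucky}}$ defined by $[\alpha]^{\mathrm{PF}}_{\mathrm{Lucky}}\mapsto Z_{\epsilon^{-1}(LW^r(\alpha))}$ is an algebra isomorphism between $\mathcal{A}^{\mathrm{PF}}_{\mathrm{Lucky}}$ and $\mathrm{QSym}$.
   Context: All algebras are over $\mathbb{Q}$. A parking function of length $n\ge0$ is a sequence $\alpha=(\alpha_1,\dots,\alpha_n)$ of positive integers whose weakly increasing rearrangement $\alpha'_1\le\dots\le\alpha'_n$ satisfies $\alpha'_i\le i$; $|\alpha|=n$. $\mathrm{PF}_n$ is the set of these and $\mathrm{PF}=\bigcup_{n\ge0}\mathrm{PF}_n$. Parking process: cars $1,\dots,n$ arrive in order on a one-way street with spots $1,\dots,n$; car $i$ parks in the first unoccupied spot $s_i\ge\alpha_i$ (all cars park exactly when $\alpha$ is a parking function). The lucky car set is $\mathrm{Lucky}(\alpha)=\{i:s_i=\alpha_i\}$. $LW(\alpha)$ is the binary word of length $n$ whose $i$-th letter is $1$ if $i\in\mathrm{Lucky}(\alpha)$ and $0$ otherwise; $LW^r(\alpha)$ is the reverse of $LW(\alpha)$; it ends in $1$ when $n\geq 1$, since car 1 is always lucky. For $\alpha\in\mathrm{PF}_n,\beta\in\mathrm{PF}_m$, the shifted shuffle $\overrightarrow{\mathrm{Sh}}(\alpha,\beta)$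 is the set of all interleavings (shuffles) of $\alpha$ and $\beta[n]=(\beta_1+n,\dots,\beta_m+n)$. A statistic $\mathrm{st}$ on $\mathrm{PF}$ is weakly shuffle-compatible on parking functions if for all $\alpha,\beta\in\mathrm{PF}$ the multiset $\{\{\mathrm{st}(\gamma):\gamma\in\overrightarrow{\mathrm{Sh}}(\alpha,\beta)\}\}$ is determined by $|\alpha|,|\beta|,\mathrm{st}(\alpha),\mathrm{st}(\beta)$. Let $[\alpha]^{\mathrm{PF}}_{\mathrm{st}}=\{\beta\in\mathrm{PF}:\mathrm{st}(\beta)=\mathrm{st}(\alpha),|\beta|=|\alpha|\}$. $\mathcal{A}^{\mathrm{PF}}_{\mathrm{st}}$ is the algebra with basis these classes and product $[\alpha]^{\mathrm{PF}}_{\mathrm{st}}[\beta]^{\mathrm{PF}}_{\mathrm{st}}=\sum_{\gamma\in\overrightarrow{\mathrm{Sh}}(\alpha,\beta)}[\gamma]^{\mathrm{PF}}_{\mathrm{st}}$. For a composition $\delta=(\delta_1,\dots,\delta_k)$ of $n\ge1$ let $\mathrm{Set}(\delta)=\{\delta_1,\delta_1+\delta_2,\dots,\delta_1+\dots+\delta_{k-1}\}$ and let $\epsilon(\delta)$ be the binary word of length $n$ with $n$-th letter $1$ and, for $1\le i<n$, $i$-th letter $1$ if $i\in\mathrm{Set}(\delta)$ and $0$ otherwise; the empty composition corresponds to the empty word. $\epsilon$ is a bijection from compositions of $n$ to binary words of length $n$ ending in $1$; $\epsilon^{-1}$ is its inverse. A binary shuffle basis of $\mathrm{QSym}$ (the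 algebra of quasisymmetric functions) is a basis $\{Z_\delta\}$ indexed by compositions with $Z_\delta Z_\eta=\sum_w Z_{\epsilon^{-1}(w)}$, the sum over the multiset of all interleavings $w$ of the words $\epsilon(\delta)$ and $\epsilon(\eta)$. Such a basis is known to exist (Novelli–Thibon). *)

theory Defs
  imports
    "Jordan_Normal_Form.VS_Connect"
    "HOL-Algebra.QuotRing"
    "HOL-Library.Poly_Mapping"
begin

section \<open>Parking functions and lucky cars\<close>

definition parking_function :: "nat list \<Rightarrow> bool" where
  "parking_function \<alpha> \<longleftrightarrow>
     (\<forall>a\<in>set \<alpha>. 1 \<le> a) \<and> (\<forall>i<length \<alpha>. sort \<alpha> ! i \<le> Suc i)"

definition PF :: "nat list set" where
  "PF = {\<alpha>. parking_function \<alpha>}"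

text \<open>\<open>park n occ \<alpha>\<close> lists the spots taken by the cars with preferences \<open>\<alpha>\<close> on a street with
  spots \<open>1, \<dots>, n\<close> of which those in \<open>occ\<close> are already taken; \<open>None\<close> means that the car leaves
  without parking.\<close>

fun park :: "nat \<Rightarrow> nat set \<Rightarrow> nat list \<Rightarrow> nat option list" where
  "park n occ [] = []"
| "park n occ (a # as) =
     (if \<exists>s. a \<le> s \<and> s \<le> n \<and> s \<notin> occ
      then let s = (LEAST s. a \<le> s \<and> s \<le> n \<and> s \<notin> occ) in Some s # park n (insert s occ) as
      else None # park n occ as)"

text \<open>Cars are numbered from 1, list positions from 0.\<close>

definition Lucky :: "nat list \<Rightarrow> nat set" where
  "Lucky \<alpha> = {i\<in>{1..length \<alpha>}. park (length \<alpha>) {} \<alpha> ! (i - 1) = Some (\<alpha> ! (i - 1))}"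

text \<open>Binary words are lists of booleans, \<open>True\<close> standing for the letter 1.\<close>

definition LW :: "nat list \<Rightarrow> bool list" where
  "LW \<alpha> = map (\<lambda>i. i \<in> Lucky \<alpha>) [1..<Suc (length \<alpha>)]"

definition LWr :: "nat list \<Rightarrow> bool list" where
  "LWr \<alpha> = rev (LW \<alpha>)"

section \<open>Shuffles and weak shuffle-compatibility\<close>

definition shifted_shuffle :: "nat list \<Rightarrow> nat list \<Rightarrow> nat list set" where
  "shifted_shuffle \<alpha> \<beta> = shuffles \<alpha> (map (\<lambda>b. b + length \<alpha>) \<beta>)"

definition weakly_shuffle_compatible :: "(nat list \<Rightarrow> 'b) \<Rightarrow> bool" where
  "weakly_shuffle_compatible st \<longleftrightarrow>
     (\<forall>\<alpha>\<in>PF. \<forall>\<beta>\<in>PF. \<forall>\<alpha>'\<in>PF. \<forall>\<beta>'\<in>PF.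
        length \<alpha> = length \<alpha>' \<longrightarrow> length \<beta> = length \<beta>' \<longrightarrow> st \<alpha> = st \<alpha>' \<longrightarrow> st \<beta> = st \<beta>' \<longrightarrow>
        image_mset st (mset_set (shifted_shuffle \<alpha> \<beta>)) =
        image_mset st (mset_set (shifted_shuffle \<alpha>' \<beta>')))"

text \<open>The interleavings of two words counted with multiplicity, i.e. one for each choice of the
  positions of the letters of the first word; \<^const>\<open>shuffles\<close> forgets the multiplicities.\<close>

fun shuffles_mset :: "'a list \<Rightarrow> 'a list \<Rightarrow> 'a list multiset" where
  "shuffles_mset [] ys = {#ys#}"
| "shuffles_mset xs [] = {#xs#}"
| "shuffles_mset (x # xs) (y # ys) =
     image_mset ((#) x) (shuffles_mset xs (y # ys)) +
     image_mset ((#) y) (shuffles_mset (x # xs) ys)"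

section \<open>The algebra of a statistic\<close>

definition pf_class :: "(nat list \<Rightarrow> 'b) \<Rightarrow> nat list \<Rightarrow> nat list set" where
  "pf_class st \<alpha> = {\<beta>\<in>PF. st \<beta> = st \<alpha> \<and> length \<beta> = length \<alpha>}"

text \<open>The product of two classes is computed from arbitrary representatives. It does not depend on
  them if \<open>st\<close> is weakly shuffle-compatible; see \<open>class_mult_pf_class\<close> below.\<close>

definition class_mult ::
  "(nat list \<Rightarrow> 'b) \<Rightarrow> nat list set \<Rightarrow> nat list set \<Rightarrow> (nat list set \<Rightarrow>\<^sub>0 rat)" where
  "class_mult st C D =
     (\<Sum>\<gamma>\<in>shifted_shuffle (SOME \<alpha>. \<alpha> \<in> C) (SOME \<beta>. \<beta> \<in> D). Poly_Mapping.single (pf_class st \<gamma>) 1)"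

lemma class_mult_pf_class:
  assumes st: "weakly_shuffle_compatible st" and \<alpha>: "\<alpha> \<in> PF" and \<beta>: "\<beta> \<in> PF"
  shows "class_mult st (pf_class st \<alpha>) (pf_class st \<beta>) =
    (\<Sum>\<gamma>\<in>shifted_shuffle \<alpha> \<beta>. Poly_Mapping.single (pf_class st \<gamma>) 1)"
proof -
  define \<alpha>' where "\<alpha>' = (SOME x. x \<in> pf_class st \<alpha>)"
  define \<beta>' where "\<beta>' = (SOME x. x \<in> pf_class st \<beta>)"
  have "\<alpha>' \<in> pf_class st \<alpha>" unfolding \<alpha>'_def by (rule someI[of _ \<alpha>]) (simp add: pf_class_def \<alpha>)
  then have a: "\<alpha>' \<in> PF" "st \<alpha>' = st \<alpha>" "length \<alpha>' = length \<alpha>" by (auto simp: pf_class_def)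
  have "\<beta>' \<in> pf_class st \<beta>" unfolding \<beta>'_def by (rule someI[of _ \<beta>]) (simp add: pf_class_def \<beta>)
  then have b: "\<beta>' \<in> PF" "st \<beta>' = st \<beta>" "length \<beta>' = length \<beta>" by (auto simp: pf_class_def)
  define g :: "_ \<Rightarrow> nat list set \<Rightarrow>\<^sub>0 rat" where
    "g = (\<lambda>t. Poly_Mapping.single {\<delta>\<in>PF. st \<delta> = t \<and> length \<delta> = length \<alpha> + length \<beta>} 1)"
  have g: "(\<Sum>\<gamma>\<in>shifted_shuffle x y. Poly_Mapping.single (pf_class st \<gamma>) 1) =
      (\<Sum>t\<in>#image_mset st (mset_set (shifted_shuffle x y)). g t)"
    if "length x = length \<alpha>" "length y = length \<beta>" for x y
    unfolding sum_unfold_sum_mset image_mset.compositionality comp_def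
    by (intro arg_cong[of _ _ sum_mset] image_mset_cong)
       (use that in \<open>auto simp: g_def pf_class_def shifted_shuffle_def dest!: length_shuffles\<close>)
  have "image_mset st (mset_set (shifted_shuffle \<alpha>' \<beta>')) =
      image_mset st (mset_set (shifted_shuffle \<alpha> \<beta>))"
    using st a b \<alpha> \<beta> unfolding weakly_shuffle_compatible_def by blast
  then show ?thesis
    using g[of \<alpha>' \<beta>'] g[of \<alpha> \<beta>] a b
    by (simp add: class_mult_def flip: \<alpha>'_def \<beta>'_def)
qed

text \<open>Elements are formal rational linear combinations of classes; the product is the bilinear
  extension of \<open>class_mult\<close>, and its unit is the class of the empty parking function.\<close>

definition PF_algebra :: "(nat list \<Rightarrow> 'b) \<Rightarrow> (rat, nat list set \<Rightarrow>\<^sub>0 rat) module" where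
  "PF_algebra st =
     \<lparr>carrier = {f. Poly_Mapping.keys f \<subseteq> pf_class st ` PF},
      mult = (\<lambda>f g. \<Sum>C\<in>Poly_Mapping.keys f. \<Sum>D\<in>Poly_Mapping.keys g.
                Poly_Mapping.map ((*) (Poly_Mapping.lookup f C * Poly_Mapping.lookup g D))
                  (class_mult st C D)),
      one = Poly_Mapping.single (pf_class st []) 1,
      zero = 0,
      add = (+),
      smult = (\<lambda>c. Poly_Mapping.map ((*) c))\<rparr>"

section \<open>Quasisymmetric functions\<close>

text \<open>A formal power series in variables \<open>x\<^sub>0, x\<^sub>1, x\<^sub>2, \<dots>\<close> is its coefficient function on
  monomials, a monomial being a finitely supported family of exponents.\<close>

type_synonym series = "(nat \<Rightarrow>\<^sub>0 nat) \<Rightarrow> rat"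

definition monomial_of :: "nat list \<Rightarrow> nat list \<Rightarrow> (nat \<Rightarrow>\<^sub>0 nat)" where
  "monomial_of ix as = (\<Sum>l<length as. Poly_Mapping.single (ix ! l) (as ! l))"

definition quasisymmetric :: "series \<Rightarrow> bool" where
  "quasisymmetric f \<longleftrightarrow>
     (\<forall>as ix jx. (\<forall>a\<in>set as. 0 < a) \<and> length ix = length as \<and> length jx = length as \<and>
        sorted_wrt (<) ix \<and> sorted_wrt (<) jx \<longrightarrow> f (monomial_of ix as) = f (monomial_of jx as))"

definition bounded_degree :: "series \<Rightarrow> bool" where
  "bounded_degree f \<longleftrightarrow>
     (\<exists>d. \<forall>m. f m \<noteq> 0 \<longrightarrow> (\<Sum>i\<in>Poly_Mapping.keys m. Poly_Mapping.lookup m i) \<le> d)"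

definition QSym :: "(rat, series) module" where
  "QSym =
     \<lparr>carrier = {f. bounded_degree f \<and> quasisymmetric f},
      mult = (\<lambda>f g m. \<Sum>(a, b)\<in>{(a, b). a + b = m}. f a * g b),
      one = (\<lambda>m. if m = 0 then 1 else 0),
      zero = (\<lambda>m. 0),
      add = (\<lambda>f g m. f m + g m),
      smult = (\<lambda>c f m. c * f m)\<rparr>"

text \<open>The sum in the product of two series is finite.\<close>

lemma finite_monomial_splittings: "finite {(a, b). a + b = (m :: nat \<Rightarrow>\<^sub>0 nat)}"
proof -
  have fin: "finite {h. \<forall>i. (i \<in> Poly_Mapping.keys m \<longrightarrow> h i \<in> {..Max (range (Poly_Mapping.lookup m))}) \<and>
      (i \<notin> Poly_Mapping.keys m \<longrightarrow> h i = 0)}" (is "finite ?H")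
    by (rule finite_set_of_finite_funs) auto
  have rng: "finite (range (Poly_Mapping.lookup m))"
  proof (rule finite_subset)
    show "range (Poly_Mapping.lookup m) \<subseteq> insert 0 (Poly_Mapping.lookup m ` Poly_Mapping.keys m)"
      by (auto simp: in_keys_iff)
  qed simp
  have *: "Poly_Mapping.lookup a \<in> ?H" if "a + b = m" for a b
  proof -
    have le: "Poly_Mapping.lookup a i \<le> Poly_Mapping.lookup m i" for i
      using that by (auto simp: lookup_add)
    have "Poly_Mapping.lookup m i \<le> Max (range (Poly_Mapping.lookup m))" for i
      using rng by simp
    then have "Poly_Mapping.lookup a i \<le> Max (range (Poly_Mapping.lookup m))" for i
      using le order_trans by blast
    moreover have "Poly_Mapping.lookup a i = 0" if "i \<notin> Poly_Mapping.keys m" for i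
      using le[of i] that by (simp add: in_keys_iff)
    ultimately show ?thesis by simp
  qed
  have "finite ((\<lambda>(a, b). (Poly_Mapping.lookup a, Poly_Mapping.lookup b)) ` {(a, b). a + b = m})"
  proof (rule finite_subset)
    have "Poly_Mapping.lookup a \<in> ?H \<and> Poly_Mapping.lookup b \<in> ?H" if "a + b = m" for a b
      using *[OF that] *[of b a] that by (simp add: add.commute)
    then have "Poly_Mapping.lookup (fst p) \<in> ?H \<and> Poly_Mapping.lookup (snd p) \<in> ?H"
      if "fst p + snd p = m" for p
      using that by blast
    then show "(\<lambda>(a, b). (Poly_Mapping.lookup a, Poly_Mapping.lookup b)) ` {(a, b). a + b = m} \<subseteq> ?H \<times> ?H"
      by (intro image_subsetI) (simp add: case_prod_unfold mem_Times_iff)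
    show "finite (?H \<times> ?H)"
      using fin by blast
  qed
  moreover have "inj_on (\<lambda>(a, b). (Poly_Mapping.lookup a, Poly_Mapping.lookup b)) {(a, b). a + b = m}"
    by (rule inj_onI) (simp add: case_prod_unfold prod_eq_iff Poly_Mapping.lookup_inject)
  ultimately show ?thesis by (rule finite_imageD)
qed

lemma QSym_add_closed:
  assumes "f \<in> carrier QSym" "g \<in> carrier QSym"
  shows "(\<lambda>m. f m + g m) \<in> carrier QSym"
proof -
  obtain d e where
    d: "\<And>m. f m \<noteq> 0 \<Longrightarrow> (\<Sum>i\<in>Poly_Mapping.keys m. Poly_Mapping.lookup m i) \<le> d" and
    e: "\<And>m. g m \<noteq> 0 \<Longrightarrow> (\<Sum>i\<in>Poly_Mapping.keys m. Poly_Mapping.lookup m i) \<le> e"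
    using assms by (auto simp: QSym_def bounded_degree_def)
  have "(\<Sum>i\<in>Poly_Mapping.keys m. Poly_Mapping.lookup m i) \<le> max d e" if "f m + g m \<noteq> 0" for m
    using that d[of m] e[of m] by (cases "f m = 0") auto
  then have "bounded_degree (\<lambda>m. f m + g m)"
    unfolding bounded_degree_def by blast
  moreover have "quasisymmetric (\<lambda>m. f m + g m)"
    unfolding quasisymmetric_def
  proof (intro allI impI)
    fix as ix jx :: "nat list"
    assume h: "(\<forall>a\<in>set as. 0 < a) \<and> length ix = length as \<and> length jx = length as \<and>
        sorted_wrt (<) ix \<and> sorted_wrt (<) jx"
    then have "f (monomial_of ix as) = f (monomial_of jx as)" "g (monomial_of ix as) = g (monomial_of jx as)"
      using assms unfolding QSym_def quasisymmetric_def by simp_all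
    then show "f (monomial_of ix as) + g (monomial_of ix as) = f (monomial_of jx as) + g (monomial_of jx as)"
      by simp
  qed
  ultimately show ?thesis by (simp add: QSym_def)
qed

lemma QSym_smult_closed:
  assumes "f \<in> carrier QSym"
  shows "(\<lambda>m. c * f m) \<in> carrier QSym"
proof -
  have "bounded_degree (\<lambda>m. c * f m)"
  proof -
    obtain d where "\<And>m. f m \<noteq> 0 \<Longrightarrow> (\<Sum>i\<in>Poly_Mapping.keys m. Poly_Mapping.lookup m i) \<le> d"
      using assms by (auto simp: QSym_def bounded_degree_def)
    then show ?thesis
      unfolding bounded_degree_def by (intro exI[of _ d]) simp
  qed
  moreover have "quasisymmetric (\<lambda>m. c * f m)"
    unfolding quasisymmetric_def
  proof (intro allI impI)
    fix as ix jx :: "nat list"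
    assume h: "(\<forall>a\<in>set as. 0 < a) \<and> length ix = length as \<and> length jx = length as \<and>
        sorted_wrt (<) ix \<and> sorted_wrt (<) jx"
    then have "f (monomial_of ix as) = f (monomial_of jx as)"
      using assms unfolding QSym_def quasisymmetric_def by simp
    then show "c * f (monomial_of ix as) = c * f (monomial_of jx as)" by simp
  qed
  ultimately show ?thesis by (simp add: QSym_def)
qed

lemma vectorspace_QSym: "vectorspace (class_ring :: rat ring) QSym"
proof -
  have "abelian_group QSym"
  proof (rule abelian_groupI)
    fix f g assume "f \<in> carrier QSym" "g \<in> carrier QSym"
    then show "f \<oplus>\<^bsub>QSym\<^esub> g \<in> carrier QSym"
      using QSym_add_closed by (simp add: QSym_def)
  next
    fix f assume "f \<in> carrier QSym"
    then have "(\<lambda>m. (- 1) * f m) \<in> carrier QSym" by (rule QSym_smult_closed)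
    then show "\<exists>g\<in>carrier QSym. g \<oplus>\<^bsub>QSym\<^esub> f = \<zero>\<^bsub>QSym\<^esub>"
      by (rule bexI[rotated]) (simp add: QSym_def)
  next
    show "\<zero>\<^bsub>QSym\<^esub> \<in> carrier QSym"
      by (simp add: QSym_def bounded_degree_def quasisymmetric_def)
  qed (simp_all add: QSym_def add_ac)
  moreover have "cring (class_ring :: rat ring)"
    using class_field by (rule fieldE(1))
  moreover have "c \<odot>\<^bsub>QSym\<^esub> f \<in> carrier QSym" if "f \<in> carrier QSym" for c f
    using QSym_smult_closed[OF that] by (simp add: QSym_def)
  ultimately have "module (class_ring :: rat ring) QSym"
    by (intro moduleI) (assumption | simp add: QSym_def algebra_simps)+
  then show ?thesis
    using class_field by (rule vectorspace.intro)
qed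

section \<open>Compositions and binary shuffle bases\<close>

definition compositions :: "nat list set" where
  "compositions = {\<delta>. \<forall>d\<in>set \<delta>. 0 < d}"

definition composition_set :: "nat list \<Rightarrow> nat set" where
  "composition_set \<delta> = {sum_list (take j \<delta>) | j. 1 \<le> j \<and> j < length \<delta>}"

definition epsilon :: "nat list \<Rightarrow> bool list" where
  "epsilon \<delta> = map (\<lambda>i. i = sum_list \<delta> \<or> i \<in> composition_set \<delta>) [1..<Suc (sum_list \<delta>)]"

lemma epsilon_Nil: "epsilon [] = []"
  by (simp add: epsilon_def)

lemma epsilon_Cons:
  assumes "0 < d" and "\<delta> \<in> compositions"
  shows "epsilon (d # \<delta>) = replicate (d - 1) False @ True # epsilon \<delta>"
proof (rule nth_equalityI)
  let ?n = "sum_list \<delta>"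
  show "length (epsilon (d # \<delta>)) = length (replicate (d - 1) False @ True # epsilon \<delta>)"
    using assms by (simp add: epsilon_def del: upt_Suc)
  have set: "i \<in> composition_set (d # \<delta>) \<longleftrightarrow> \<delta> \<noteq> [] \<and> (i = d \<or> (d < i \<and> i - d \<in> composition_set \<delta>))" for i
  proof -
    have pos: "0 < sum_list (take j \<delta>)" if "1 \<le> j" "j < length \<delta>" for j
      using assms(2) that by (cases \<delta>; cases j) (auto simp: compositions_def)
    have "i \<in> composition_set (d # \<delta>) \<longleftrightarrow> (\<exists>j. j < length \<delta> \<and> i = d + sum_list (take j \<delta>))"
    proof
      assume "i \<in> composition_set (d # \<delta>)"
      then obtain j where j: "1 \<le> j" "j < length (d # \<delta>)" "i = sum_list (take j (d # \<delta>))"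
        by (auto simp: composition_set_def)
      then show "\<exists>j. j < length \<delta> \<and> i = d + sum_list (take j \<delta>)"
        by (intro exI[of _ "j - 1"]) (cases j; simp)
    next
      assume "\<exists>j. j < length \<delta> \<and> i = d + sum_list (take j \<delta>)"
      then obtain j where j: "j < length \<delta>" "i = d + sum_list (take j \<delta>)" by blast
      then show "i \<in> composition_set (d # \<delta>)"
        unfolding composition_set_def by (auto intro!: exI[of _ "Suc j"])
    qed
    also have "\<dots> \<longleftrightarrow> \<delta> \<noteq> [] \<and> (i = d \<or> (d < i \<and> i - d \<in> composition_set \<delta>))"
    proof (intro iffI; (elim exE conjE)?)
      fix j assume "j < length \<delta>" "i = d + sum_list (take j \<delta>)"
      then show "\<delta> \<noteq> [] \<and> (i = d \<or> (d < i \<and> i - d \<in> composition_set \<delta>))"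
        using pos[of j] by (cases j) (auto simp: composition_set_def)
    next
      assume h: "\<delta> \<noteq> []" "i = d \<or> (d < i \<and> i - d \<in> composition_set \<delta>)"
      show "\<exists>j. j < length \<delta> \<and> i = d + sum_list (take j \<delta>)"
      proof (cases "i = d")
        case True
        then show ?thesis using h by (intro exI[of _ 0]) simp
      next
        case False
        then have "d < i" "i - d \<in> composition_set \<delta>" using h by auto
        then obtain j where "j < length \<delta>" "i - d = sum_list (take j \<delta>)"
          by (auto simp: composition_set_def)
        with \<open>d < i\<close> show ?thesis by (intro exI[of _ j]) auto
      qed
    qed
    finally show ?thesis .
  qed
  have n0: "?n = 0 \<longleftrightarrow> \<delta> = []" using assms(2) by (cases \<delta>) (auto simp: compositions_def)
  fix i assume "i < length (epsilon (d # \<delta>))"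
  then have i: "i < d + ?n" by (simp add: epsilon_def del: upt_Suc)
  then have l: "epsilon (d # \<delta>) ! i \<longleftrightarrow> Suc i = d + ?n \<or> Suc i \<in> composition_set (d # \<delta>)"
    by (simp add: epsilon_def del: upt_Suc)
  consider "Suc i < d" | "Suc i = d" | "d \<le> i" by linarith
  then show "epsilon (d # \<delta>) ! i = (replicate (d - 1) False @ True # epsilon \<delta>) ! i"
  proof cases
    case 1
    then have "i < d - 1" by simp
    then have "\<not> (replicate (d - 1) False @ True # epsilon \<delta>) ! i" by (simp add: nth_append)
    moreover have "\<not> epsilon (d # \<delta>) ! i"
      unfolding l set using 1 by auto
    ultimately show ?thesis by simp
  next
    case 2
    then have "i = d - 1" by simp
    then have "(replicate (d - 1) False @ True # epsilon \<delta>) ! i" by (simp add: nth_append)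
    moreover have "epsilon (d # \<delta>) ! i"
      unfolding l set using 2 n0 by auto
    ultimately show ?thesis by simp
  next
    case 3
    then obtain k where k: "i = d + k" using le_Suc_ex by blast
    have "((replicate (d - 1) False @ [True]) @ epsilon \<delta>) ! (length (replicate (d - 1) False @ [True]) + k) =
        epsilon \<delta> ! k"
      by (rule nth_append_length_plus)
    then have "(replicate (d - 1) False @ True # epsilon \<delta>) ! i = epsilon \<delta> ! k"
      using \<open>0 < d\<close> k by simp
    also have "\<dots> \<longleftrightarrow> Suc k = ?n \<or> Suc k \<in> composition_set \<delta>"
      using i k by (simp add: epsilon_def del: upt_Suc)
    also have "\<dots> \<longleftrightarrow> epsilon (d # \<delta>) ! i"
    proof -
      have "\<delta> \<noteq> []" using i k by auto
      moreover have "Suc i - d = Suc k" "d < Suc i" "Suc i \<noteq> d" "Suc i = d + ?n \<longleftrightarrow> Suc k = ?n"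
        using k by simp_all
      ultimately show ?thesis unfolding l set by simp
    qed
    finally show ?thesis by simp
  qed
qed

lemma bij_betw_epsilon: "bij_betw epsilon compositions {w. w \<noteq> [] \<longrightarrow> last w}"
proof -
  have inj: "\<delta> = \<eta>" if "\<delta> \<in> compositions" "\<eta> \<in> compositions" "epsilon \<delta> = epsilon \<eta>" for \<delta> \<eta>
    using that
  proof (induction \<delta> arbitrary: \<eta>)
    case Nil
    then show ?case by (cases \<eta>) (auto simp: epsilon_Nil epsilon_Cons compositions_def)
  next
    case (Cons d \<delta>)
    then have d: "0 < d" "\<delta> \<in> compositions" by (auto simp: compositions_def)
    with Cons.prems(3) obtain e \<eta>' where e: "\<eta> = e # \<eta>'"
      by (cases \<eta>) (auto simp: epsilon_Nil epsilon_Cons)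
    with Cons.prems(2) have e': "0 < e" "\<eta>' \<in> compositions" by (auto simp: compositions_def)
    have eq: "replicate (d - 1) False @ True # epsilon \<delta> = replicate (e - 1) False @ True # epsilon \<eta>'"
      using Cons.prems(3) d e e' by (simp add: epsilon_Cons)
    have tw: "takeWhile Not (replicate k False @ True # w) = replicate k False" for k w
      by (induction k) auto
    have "d - 1 = e - 1"
      using arg_cong[OF eq, of "\<lambda>w. length (takeWhile Not w)"] by (simp only: tw length_replicate)
    then have "d = e" "epsilon \<delta> = epsilon \<eta>'" using eq d e' by auto
    then show ?case using Cons.IH[of \<eta>'] d e e' by simp
  qed
  have "epsilon \<delta> \<noteq> [] \<longrightarrow> last (epsilon \<delta>)" if "\<delta> \<in> compositions" for \<delta>
    using that by (induction \<delta>) (auto simp: epsilon_Nil epsilon_Cons compositions_def)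
  moreover have "\<exists>\<delta>\<in>compositions. epsilon \<delta> = w" if "w \<noteq> [] \<longrightarrow> last w" for w
    using that
  proof (induction w)
    case Nil
    then show ?case by (intro bexI[of _ "[]"]) (auto simp: compositions_def epsilon_Nil)
  next
    case (Cons x w)
    then obtain \<delta> where \<delta>: "\<delta> \<in> compositions" "epsilon \<delta> = w" by (auto split: if_splits)
    show ?case
    proof (cases x)
      case True
      then show ?thesis using \<delta>
        by (intro bexI[of _ "1 # \<delta>"]) (auto simp: epsilon_Cons compositions_def)
    next
      case False
      then have "w \<noteq> []" using Cons.prems by auto
      then obtain d \<delta>' where d: "\<delta> = d # \<delta>'" using \<delta> by (cases \<delta>) (auto simp: epsilon_Nil)
      then have d': "0 < d" "\<delta>' \<in> compositions" using \<delta> by (auto simp: compositions_def)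
      then have "epsilon (Suc d # \<delta>') = False # epsilon (d # \<delta>')"
        by (cases d) (auto simp: epsilon_Cons)
      then show ?thesis using \<delta> d d' False
        by (intro bexI[of _ "Suc d # \<delta>'"]) (auto simp: compositions_def)
    qed
  qed
  ultimately have "epsilon ` compositions = {w. w \<noteq> [] \<longrightarrow> last w}"
    by (simp only: set_eq_iff image_iff mem_Collect_eq) metis
  moreover have "inj_on epsilon compositions"
    using inj by (rule inj_onI)
  ultimately show ?thesis
    by (simp add: bij_betw_def)
qed

definition epsilon_inv :: "bool list \<Rightarrow> nat list" where
  "epsilon_inv = inv_into compositions epsilon"

text \<open>The last clause states \<open>Z\<^sub>\<delta> Z\<^sub>\<eta> = (\<Sum>w. Z (\<epsilon>\<^sup>-\<^sup>1 w))\<close> coefficientwise.\<close>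

definition binary_shuffle_basis :: "(nat list \<Rightarrow> series) \<Rightarrow> bool" where
  "binary_shuffle_basis Z \<longleftrightarrow>
     inj_on Z compositions \<and>
     vectorspace.basis (class_ring :: rat ring) QSym (Z ` compositions) \<and>
     (\<forall>\<delta>\<in>compositions. \<forall>\<eta>\<in>compositions. \<forall>m.
        (Z \<delta> \<otimes>\<^bsub>QSym\<^esub> Z \<eta>) m =
        (\<Sum>w\<in>#shuffles_mset (epsilon \<delta>) (epsilon \<eta>). Z (epsilon_inv w) m))"

section \<open>Algebra isomorphisms\<close>

definition algebra_isomorphism ::
  "('k, 'm) ring_scheme \<Rightarrow> ('k, 'a, 'n) module_scheme \<Rightarrow> ('k, 'b, 'p) module_scheme \<Rightarrow>
   ('a \<Rightarrow> 'b) \<Rightarrow> bool" where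
  "algebra_isomorphism K A B \<phi> \<longleftrightarrow>
     algebra K A \<and> algebra K B \<and> \<phi> \<in> LinearCombinations.module_hom K A B \<and> \<phi> \<in> ring_iso A B"

end

theory Submission
  imports Defs
begin

text \<open>In a shifted shuffle of \<open>\<alpha> \<in> PF\<^sub>n\<close> and \<open>\<beta>\<close>, the cars of \<open>\<alpha>\<close> fill exactly the spots
  \<open>1, \<dots>, n\<close> and the shifted cars of \<open>\<beta>\<close> prefer spots beyond \<open>n\<close>. Hence the two families park
  independently, and the lucky words of the shuffles are the interleavings of \<open>LW \<alpha>\<close> and
  \<open>LW \<beta>\<close>. Reversing words, the classes multiply like the elements of a binary shuffle basis. They
  correspond bijectively to the binary words ending in 1, because every word starting with 1 is
  the lucky word of a parking function. That \<open>QSym\<close> is closed under multiplication comes for free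
  from the existence of a binary shuffle basis.\<close>

section \<open>Lucky words of shuffles\<close>

lemma shuffles_mset_Nil_right [simp]: "shuffles_mset xs [] = {#xs#}"
  by (cases xs) auto

text \<open>Disjoint alphabets make the two possible first letters distinct, so no interleaving
  arises in two ways and every multiplicity is 1.\<close>

lemma mset_set_shuffles:
  assumes "set xs \<inter> set ys = {}"
  shows "mset_set (shuffles xs ys) = shuffles_mset xs ys"
  using assms
proof (induction xs ys rule: shuffles_mset.induct)
  case (3 x xs y ys)
  then have "x \<noteq> y" by auto
  then have "(#) x ` shuffles xs (y # ys) \<inter> (#) y ` shuffles (x # xs) ys = {}" by auto
  with 3 show ?case
    by (simp add: mset_set_Union flip: image_mset_mset_set)
qed simp_all

text \<open>The defining recursion peels off first letters; this is its mirror image on last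
  letters, which is what reversal needs. The nested inductions follow the recursion on both
  words.\<close>

lemma shuffles_mset_snoc:
  "shuffles_mset (xs @ [x]) (ys @ [y]) =
     image_mset (\<lambda>w. w @ [x]) (shuffles_mset xs (ys @ [y])) +
     image_mset (\<lambda>w. w @ [y]) (shuffles_mset (xs @ [x]) ys)"
proof (induction xs arbitrary: ys)
  case Nil
  then show ?case
    by (induction ys) (simp_all add: image_mset.compositionality comp_def add_ac)
next
  case IH: (Cons a xs)
  show ?case
  proof (induction ys)
    case Nil
    then show ?case
      using IH[of "[]"] by (simp add: image_mset.compositionality comp_def add_ac)
  next
    case (Cons b ys)
    then show ?case
      using IH[of "b # ys"] by (simp add: image_mset.compositionality comp_def add_ac)
  qed
qed

text \<open>Reversal exchanges the recursion on first letters with the one on last letters.\<close>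

lemma shuffles_mset_rev:
  "shuffles_mset (rev xs) (rev ys) = image_mset rev (shuffles_mset xs ys)"
proof (induction xs ys rule: shuffles_mset.induct)
  case (3 x xs y ys)
  then show ?case
    by (simp add: shuffles_mset_snoc image_mset.compositionality comp_def)
qed simp_all

section \<open>Lucky words on partly occupied streets\<close>

text \<open>Street length and taken spots are parameters so that induction over the cars is
  possible: the cars after the first meet the same street with a possibly larger \<open>occ\<close>.
  A car that leaves has spot \<open>None\<close> and gets the letter \<open>False\<close>.\<close>

definition lucky_word :: "nat \<Rightarrow> nat set \<Rightarrow> nat list \<Rightarrow> bool list" where
  "lucky_word n occ \<alpha> = map2 (\<lambda>p a. p = Some a) (park n occ \<alpha>) \<alpha>"

lemma length_park [simp]: "length (park n occ \<alpha>) = length \<alpha>"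
  by (induction n occ \<alpha> rule: park.induct) (simp_all add: Let_def)

lemma lucky_word_Nil [simp]: "lucky_word n occ [] = []"
  by (simp add: lucky_word_def)

lemma LW_eq_lucky_word: "LW \<alpha> = lucky_word (length \<alpha>) {} \<alpha>"
  by (rule nth_equalityI) (auto simp: LW_def Lucky_def lucky_word_def simp del: upt_Suc)

text \<open>The hypotheses characterise \<open>s\<close> as the first free spot from
  \<open>a\<close> on, so that later arguments need no \<open>LEAST\<close>.\<close>

lemma lucky_word_Cons_parked:
  assumes "a \<le> s" "s \<le> n" "s \<notin> occ" "{a..<s} \<subseteq> occ"
  shows "lucky_word n occ (a # as) = (s = a) # lucky_word n (insert s occ) as"
proof -
  have "(LEAST s. a \<le> s \<and> s \<le> n \<and> s \<notin> occ) = s"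
    using assms by (intro Least_equality) (auto simp: subset_iff not_less[symmetric])
  moreover have "\<exists>s. a \<le> s \<and> s \<le> n \<and> s \<notin> occ" using assms by auto
  ultimately show ?thesis by (simp add: lucky_word_def)
qed

lemma lucky_word_Cons_unparked:
  assumes "{a..n} \<subseteq> occ"
  shows "lucky_word n occ (a # as) = False # lucky_word n occ as"
proof -
  have "\<not> (\<exists>s. a \<le> s \<and> s \<le> n \<and> s \<notin> occ)" using assms by auto
  then show ?thesis unfolding lucky_word_def park.simps(2) by (simp only: if_False) simp
qed

lemma first_free_spot_cases:
  fixes a n :: nat
  obtains (parked) s where "a \<le> s" "s \<le> n" "s \<notin> occ" "{a..<s} \<subseteq> occ"
    | (unparked) "{a..n} \<subseteq> occ"
proof (cases "{a..n} \<subseteq> occ")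
  case False
  define s where "s = (LEAST s. a \<le> s \<and> s \<le> n \<and> s \<notin> occ)"
  from False have ex: "\<exists>s. a \<le> s \<and> s \<le> n \<and> s \<notin> occ" by auto
  have s: "a \<le> s \<and> s \<le> n \<and> s \<notin> occ" unfolding s_def using ex by (rule LeastI_ex)
  have "t \<in> occ" if "a \<le> t" "t < s" for t
    using not_less_Least[of t "\<lambda>s. a \<le> s \<and> s \<le> n \<and> s \<notin> occ"] that s unfolding s_def by auto
  with s show ?thesis by (intro parked[of s]) auto
qed (use unparked in simp)

text \<open>Hall's condition for the cars \<open>\<alpha>\<close> arriving while the spots \<open>occ\<close> are taken. It is an
  invariant of the parking process.\<close>

definition parkable :: "nat \<Rightarrow> nat set \<Rightarrow> nat list \<Rightarrow> bool" where
  "parkable n occ \<alpha> \<longleftrightarrow>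
     (\<forall>k. card (occ \<inter> {k..n}) + length (filter (\<lambda>a. k \<le> a) \<alpha>) \<le> Suc n - k)"

text \<open>If all spots from \<open>a\<close> to \<open>n\<close> were taken, the arriving car
  would violate Hall's bound at \<open>k = a\<close>; hence it parks. The bounds for the remaining
  cars are checked according to the position of \<open>k\<close> relative to \<open>a\<close> and
  \<open>s\<close>: for \<open>k \<le> a\<close> one car is traded for one taken spot, and for
  \<open>k > s\<close> the new spot is not counted.\<close>

lemma parkable_Cons:
  assumes "parkable n occ (a # as)"
  obtains s where "a \<le> s" "s \<le> n" "s \<notin> occ" "{a..<s} \<subseteq> occ" "parkable n (insert s occ) as"
proof (cases rule: first_free_spot_cases[where a = a and n = n and occ = occ])
  case (parked s)
  have "card (insert s occ \<inter> {k..n}) + length (filter (\<lambda>a. k \<le> a) as) \<le> Suc n - k" for k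
  proof -
    have k: "card (occ \<inter> {k..n}) + length (filter (\<lambda>a. k \<le> a) (a # as)) \<le> Suc n - k"
      using assms unfolding parkable_def by blast
    consider "k \<le> a" | "s < k" | "a < k" "k \<le> s" by linarith
    then show ?thesis
    proof cases
      case 1
      then have "insert s occ \<inter> {k..n} = insert s (occ \<inter> {k..n})" using parked by auto
      then show ?thesis using k 1 parked by simp
    next
      case 2
      then have "insert s occ \<inter> {k..n} = occ \<inter> {k..n}" by auto
      then show ?thesis using k by (simp split: if_splits)
    next
      case 3
      \<comment> \<open>Here the new spot is counted at \<open>k\<close> but the departing car is
        not, so the old bound at \<open>k\<close> is too weak. The bound at \<open>a\<close>
        suffices, because the \<open>k - a\<close> spots from \<open>a\<close> up to
        \<open>k - 1\<close> are all taken.\<close>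
      have a: "card (occ \<inter> {a..n}) + length (filter (\<lambda>b. a \<le> b) (a # as)) \<le> Suc n - a"
        using assms unfolding parkable_def by blast
      have "insert s occ \<inter> {k..n} = insert s (occ \<inter> {k..n})" using parked 3 by auto
      then have "card (insert s occ \<inter> {k..n}) = Suc (card (occ \<inter> {k..n}))"
        using parked by simp
      moreover have "occ \<inter> {a..n} = {a..<k} \<union> (occ \<inter> {k..n})"
        using parked 3 by (auto simp: subset_iff)
      then have "card (occ \<inter> {a..n}) = (k - a) + card (occ \<inter> {k..n})"
        by (simp add: card_Un_disjoint ivl_disj_int disjoint_iff)
      moreover have "length (filter (\<lambda>b. k \<le> b) as) \<le> length (filter (\<lambda>b. a \<le> b) as)"
        using 3 by (induction as) auto
      ultimately show ?thesis using a 3 parked by simp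
    qed
  qed
  then show ?thesis using parked that by (simp add: parkable_def)
next
  case unparked
  have "card (occ \<inter> {a..n}) + length (filter (\<lambda>b. a \<le> b) (a # as)) \<le> Suc n - a"
    using assms unfolding parkable_def by blast
  moreover have "occ \<inter> {a..n} = {a..n}" using unparked by auto
  ultimately show ?thesis by simp
qed

section \<open>Parking functions through Hall's condition\<close>

text \<open>On an empty street Hall's condition says that at most \<open>n + 1 - k\<close>
  preferences are at least \<open>k\<close>. This is the sorted criterion, counted from the other
  end.\<close>

lemma parking_function_iff_parkable:
  "parking_function \<alpha> \<longleftrightarrow> 0 \<notin> set \<alpha> \<and> parkable (length \<alpha>) {} \<alpha>"
proof -
  let ?n = "length \<alpha>" and ?s = "sort \<alpha>"
  have len: "length (filter P \<alpha>) = length (filter P ?s)" for P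
    by (metis mset_filter mset_sort size_mset)
  have "(\<forall>i<?n. ?s ! i \<le> Suc i) \<longleftrightarrow> (\<forall>k. length (filter (\<lambda>a. k \<le> a) \<alpha>) \<le> Suc ?n - k)"
  proof (intro iffI allI impI)
    fix k assume h: "\<forall>i<?n. ?s ! i \<le> Suc i"
    \<comment> \<open>The first \<open>k - 1\<close> sorted entries are below \<open>k\<close>, so
      all entries that are at least \<open>k\<close> lie among the rest. For \<open>k = 0\<close>
      truncated subtraction makes this prefix empty and the bound trivial.\<close>
    have "\<not> k \<le> a" if "a \<in> set (take (k - 1) ?s)" for a
    proof -
      from that obtain i where "i < k - 1" "i < ?n" "a = ?s ! i" by (auto simp: in_set_conv_nth)
      with h have "a \<le> Suc i" "Suc i < k" by auto
      then show ?thesis by simp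
    qed
    then have "filter (\<lambda>a. k \<le> a) (take (k - 1) ?s) = []"
      unfolding filter_empty_conv by blast
    then have "filter (\<lambda>a. k \<le> a) (take (k - 1) ?s @ drop (k - 1) ?s) =
        filter (\<lambda>a. k \<le> a) (drop (k - 1) ?s)"
      unfolding filter_append by simp
    then have "length (filter (\<lambda>a. k \<le> a) \<alpha>) = length (filter (\<lambda>a. k \<le> a) (drop (k - 1) ?s))"
      unfolding len append_take_drop_id by simp
    then have "length (filter (\<lambda>a. k \<le> a) \<alpha>) \<le> length (drop (k - 1) ?s)"
      by (simp only: length_filter_le)
    then show "length (filter (\<lambda>a. k \<le> a) \<alpha>) \<le> Suc ?n - k" by (cases k) auto
  next
    fix i assume h: "\<forall>k. length (filter (\<lambda>a. k \<le> a) \<alpha>) \<le> Suc ?n - k" and i: "i < ?n"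
    show "?s ! i \<le> Suc i"
    proof (rule ccontr)
      assume "\<not> ?s ! i \<le> Suc i"
      \<comment> \<open>The bound is violated at \<open>k = i + 2\<close>: all \<open>n - i\<close>
        sorted entries from position \<open>i\<close> on reach \<open>k\<close>, while only
        \<open>n - i - 1\<close> may.\<close>
      then have gt: "Suc (Suc i) \<le> ?s ! i" by simp
      have "Suc (Suc i) \<le> a" if "a \<in> set (drop i ?s)" for a
      proof -
        from that obtain j where j: "j < ?n - i" "a = ?s ! (i + j)" by (auto simp: in_set_conv_nth)
        have "?s ! i \<le> ?s ! (i + j)" using j by (intro sorted_nth_mono) auto
        with gt j show ?thesis by simp
      qed
      then have "filter (\<lambda>a. Suc (Suc i) \<le> a) (drop i ?s) = drop i ?s"
        unfolding filter_id_conv by blast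
      then have "length (drop i ?s) \<le> length (filter (\<lambda>a. Suc (Suc i) \<le> a) (take i ?s @ drop i ?s))"
        unfolding filter_append by simp
      also have "\<dots> = length (filter (\<lambda>a. Suc (Suc i) \<le> a) \<alpha>)"
        unfolding len append_take_drop_id ..
      also have "\<dots> \<le> Suc ?n - Suc (Suc i)" using h by blast
      finally show False using i by simp
    qed
  qed
  moreover have "(\<forall>a\<in>set \<alpha>. 1 \<le> a) \<longleftrightarrow> 0 \<notin> set \<alpha>"
    by (metis less_one not_le)
  ultimately show ?thesis
    unfolding parking_function_def parkable_def by (simp only: Int_empty_left card.empty add_0)
qed

text \<open>Preferences that are at least \<open>k\<close> are counted separately in the two
  families. For \<open>k \<le> n\<close> the bound for \<alpha> is increased by at most all cars of
  \<beta>; for \<open>k > n\<close> no car of \<alpha> counts and the bound for \<beta> at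
  \<open>k - n\<close> applies.\<close>

lemma shifted_shuffle_PF:
  assumes "\<alpha> \<in> PF" "\<beta> \<in> PF" "\<gamma> \<in> shifted_shuffle \<alpha> \<beta>"
  shows "\<gamma> \<in> PF"
proof -
  let ?n = "length \<alpha>" and ?m = "length \<beta>"
  have a: "0 \<notin> set \<alpha>" "\<And>k. length (filter (\<lambda>a. k \<le> a) \<alpha>) \<le> Suc ?n - k"
    and b: "0 \<notin> set \<beta>" "\<And>k. length (filter (\<lambda>a. k \<le> a) \<beta>) \<le> Suc ?m - k"
    using assms by (auto simp: PF_def parking_function_iff_parkable parkable_def)
  have \<gamma>: "\<gamma> \<in> shuffles \<alpha> (map (\<lambda>b. b + ?n) \<beta>)"
    using assms by (simp add: shifted_shuffle_def)
  have split: "length (filter P \<gamma>) = length (filter P \<alpha>) + length (filter (\<lambda>b. P (b + ?n)) \<beta>)" for P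
  proof -
    have "mset \<gamma> = mset (\<alpha> @ map (\<lambda>b. b + ?n) \<beta>)"
      using mset_shuffles[OF \<gamma>] by simp
    then have "mset (filter P \<gamma>) = mset (filter P (\<alpha> @ map (\<lambda>b. b + ?n) \<beta>))"
      unfolding mset_filter by simp
    then have "length (filter P \<gamma>) = length (filter P (\<alpha> @ map (\<lambda>b. b + ?n) \<beta>))"
      by (rule mset_eq_length)
    then show ?thesis by (simp add: filter_map comp_def)
  qed
  have "length (filter (\<lambda>a. k \<le> a) \<gamma>) \<le> Suc (?n + ?m) - k" for k
  proof (cases "k \<le> ?n")
    case True
    have "length (filter (\<lambda>b. k \<le> b + ?n) \<beta>) \<le> ?m" by (rule length_filter_le)
    with True a(2)[of k] show ?thesis unfolding split by linarith
  next
    case False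
    then have "(\<lambda>b. k \<le> b + ?n) = (\<lambda>b. k - ?n \<le> b)" by auto
    with False a(2)[of k] b(2)[of "k - ?n"] show ?thesis unfolding split by auto
  qed
  moreover have "length \<gamma> = ?n + ?m" using length_shuffles[OF \<gamma>] by simp
  moreover have "set \<gamma> = set \<alpha> \<union> (\<lambda>b. b + ?n) ` set \<beta>" using set_shuffles[OF \<gamma>] by simp
  ultimately show ?thesis
    using a(1) b(1) by (auto simp: PF_def parking_function_iff_parkable parkable_def)
qed

section \<open>Independence of the two families of cars\<close>

text \<open>Hall's condition gives every car of \<alpha> a spot up to \<open>n\<close>, so neither
  the added spots nor cars parked beyond \<open>n\<close> are noticed. With
  \<open>0 \<notin> P\<close> all shifted spots really lie beyond \<open>n\<close>.\<close>

lemma lucky_word_extend_street: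
  assumes "parkable n occ \<alpha>" and "0 \<notin> P"
  shows "lucky_word (n + m) (occ \<union> (\<lambda>p. p + n) ` P) \<alpha> = lucky_word n occ \<alpha>"
  using assms
proof (induction \<alpha> arbitrary: occ)
  case (Cons a \<alpha>)
  from Cons.prems(1) obtain s where
    s: "a \<le> s" "s \<le> n" "s \<notin> occ" "{a..<s} \<subseteq> occ" "parkable n (insert s occ) \<alpha>"
    by (rule parkable_Cons)
  have "lucky_word (n + m) (occ \<union> (\<lambda>p. p + n) ` P) (a # \<alpha>) =
      (s = a) # lucky_word (n + m) (insert s (occ \<union> (\<lambda>p. p + n) ` P)) \<alpha>"
    using s Cons.prems by (intro lucky_word_Cons_parked) auto
  then show ?case
    using Cons.IH[OF s(5) Cons.prems(2)] lucky_word_Cons_parked[OF s(1-4)] by simp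
qed simp

text \<open>Since \<open>0 < b\<close>, the shifted car searches only beyond \<open>n\<close>, where
  the taken spots are exactly those of \<open>P\<close> translated by \<open>n\<close>. The tail
  \<open>as\<close> stays arbitrary because in a shuffle it may still contain cars of the first
  family.\<close>

lemma lucky_word_shift_Cons:
  assumes "occ \<subseteq> {..n}" "0 < b"
  obtains (parked) s where
      "0 < s" "lucky_word m P (b # bs) = (s = b) # lucky_word m (insert s P) bs"
      "\<And>as. lucky_word (n + m) (occ \<union> (\<lambda>p. p + n) ` P) ((b + n) # as) =
         (s = b) # lucky_word (n + m) (occ \<union> (\<lambda>p. p + n) ` insert s P) as"
    | (unparked)
      "lucky_word m P (b # bs) = False # lucky_word m P bs"
      "\<And>as. lucky_word (n + m) (occ \<union> (\<lambda>p. p + n) ` P) ((b + n) # as) =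
         False # lucky_word (n + m) (occ \<union> (\<lambda>p. p + n) ` P) as"
proof (cases rule: first_free_spot_cases[where a = b and n = m and occ = P])
  case s: (parked s)
  have sub: "{b + n..<s + n} \<subseteq> (\<lambda>p. p + n) ` P"
  proof
    fix t assume "t \<in> {b + n..<s + n}"
    then have "t - n \<in> {b..<s}" "t = (t - n) + n" by auto
    then show "t \<in> (\<lambda>p. p + n) ` P" using s(4) by blast
  qed
  have "lucky_word (n + m) (occ \<union> (\<lambda>p. p + n) ` P) ((b + n) # as) =
      (s + n = b + n) # lucky_word (n + m) (insert (s + n) (occ \<union> (\<lambda>p. p + n) ` P)) as" for as
    by (rule lucky_word_Cons_parked) (use s sub assms in auto)
  then show ?thesis
    using s assms by (intro parked[of s]) (simp_all add: lucky_word_Cons_parked)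
next
  case s: unparked
  have "{b + n..n + m} \<subseteq> (\<lambda>p. p + n) ` P"
  proof
    fix t assume "t \<in> {b + n..n + m}"
    then have "t - n \<in> {b..m}" "t = (t - n) + n" by auto
    then show "t \<in> (\<lambda>p. p + n) ` P" using s by blast
  qed
  then show ?thesis
    using s by (intro unparked) (auto intro!: lucky_word_Cons_unparked)
qed

text \<open>This is the case of a shuffle in which the cars of the first family have all
  arrived.\<close>

lemma lucky_word_shift:
  assumes "occ \<subseteq> {..n}" "0 \<notin> set \<beta>"
  shows "lucky_word (n + m) (occ \<union> (\<lambda>p. p + n) ` P) (map (\<lambda>b. b + n) \<beta>) = lucky_word m P \<beta>"
  using assms(2)
proof (induction \<beta> arbitrary: P)
  case (Cons b \<beta>)
  then have "0 < b" "0 \<notin> set \<beta>" by auto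
  from assms(1) this(1) show ?case
  proof (cases rule: lucky_word_shift_Cons[where m = m and P = P and bs = \<beta>])
    case (parked s)
    then show ?thesis using Cons.IH[OF \<open>0 \<notin> set \<beta>\<close>, of "insert s P"] by simp
  next
    case unparked
    then show ?thesis using Cons.IH[OF \<open>0 \<notin> set \<beta>\<close>] by simp
  qed
qed simp

lemma image_mset_Cons_comp: "image_mset (\<lambda>w. c # f w) M = image_mset ((#) c) (image_mset f M)"
  by (simp add: image_mset.compositionality comp_def)

text \<open>The cars with preferences \<open>\<alpha>\<close> never leave the spots \<open>1, \<dots>, n\<close>, and the shifted cars never
  enter them, so that the two families park independently of each other.\<close>

lemma lucky_word_shuffles_mset:
  assumes "parkable n occ \<alpha>" "occ \<subseteq> {..n}" "0 \<notin> P" "0 \<notin> set \<beta>"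
  shows "image_mset (lucky_word (n + m) (occ \<union> (\<lambda>p. p + n) ` P))
      (shuffles_mset \<alpha> (map (\<lambda>b. b + n) \<beta>)) =
    shuffles_mset (lucky_word n occ \<alpha>) (lucky_word m P \<beta>)"
  using assms
proof (induction \<alpha> \<beta> arbitrary: occ P rule: shuffles_mset.induct)
  case (1 \<beta>)
  then show ?case by (simp add: lucky_word_shift)
next
  case (2 a \<alpha>)
  then show ?case by (simp add: lucky_word_extend_street)
next
  case (3 a \<alpha> b \<beta>)
  let ?occ = "occ \<union> (\<lambda>p. p + n) ` P"
  from 3(3) obtain s where
    s: "a \<le> s" "s \<le> n" "s \<notin> occ" "{a..<s} \<subseteq> occ" "parkable n (insert s occ) \<alpha>"
    by (rule parkable_Cons)
  have "lucky_word (n + m) ?occ (a # w) = (s = a) # lucky_word (n + m) (insert s occ \<union> (\<lambda>p. p + n) ` P) w" for w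
    using s 3 by (subst lucky_word_Cons_parked[of _ s]) auto
  moreover have "image_mset (lucky_word (n + m) (insert s occ \<union> (\<lambda>p. p + n) ` P))
      (shuffles_mset \<alpha> (map (\<lambda>b. b + n) (b # \<beta>))) =
    shuffles_mset (lucky_word n (insert s occ) \<alpha>) (lucky_word m P (b # \<beta>))"
    using s 3 by (intro 3(1)) auto
  ultimately have left: "image_mset (\<lambda>w. lucky_word (n + m) ?occ (a # w))
      (shuffles_mset \<alpha> (map (\<lambda>b. b + n) (b # \<beta>))) =
    image_mset ((#) (s = a)) (shuffles_mset (lucky_word n (insert s occ) \<alpha>) (lucky_word m P (b # \<beta>)))"
    by (simp only: image_mset_Cons_comp[of _ "lucky_word (n + m) (insert s occ \<union> (\<lambda>p. p + n) ` P)"])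
  have b: "0 < b" "0 \<notin> set \<beta>" using 3 by auto
  \<comment> \<open>The letter \<open>c\<close> and the new set \<open>P'\<close> cover both
    outcomes at once. No parkability is assumed for \<beta>, so its first car may leave; then
    \<open>c\<close> is \<open>False\<close> and \<open>P'\<close> is \<open>P\<close>.\<close>
  obtain c P' where c: "0 \<notin> P'" "lucky_word m P (b # \<beta>) = c # lucky_word m P' \<beta>"
    "\<And>w. lucky_word (n + m) ?occ ((b + n) # w) =
       c # lucky_word (n + m) (occ \<union> (\<lambda>p. p + n) ` P') w"
    using 3(4) b(1)
  proof (cases rule: lucky_word_shift_Cons[where m = m and P = P and bs = \<beta>])
    case (parked t)
    then show ?thesis using 3 by (intro that[of "insert t P" "t = b"]) auto
  next
    case unparked
    then show ?thesis using 3 by (intro that[of P False]) auto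
  qed
  have "image_mset (lucky_word (n + m) (occ \<union> (\<lambda>p. p + n) ` P'))
      (shuffles_mset (a # \<alpha>) (map (\<lambda>b. b + n) \<beta>)) =
    shuffles_mset (lucky_word n occ (a # \<alpha>)) (lucky_word m P' \<beta>)"
    using 3 b c by (intro 3(2)) auto
  with c(3) have right: "image_mset (\<lambda>w. lucky_word (n + m) ?occ ((b + n) # w))
      (shuffles_mset (a # \<alpha>) (map (\<lambda>b. b + n) \<beta>)) =
    image_mset ((#) c) (shuffles_mset (lucky_word n occ (a # \<alpha>)) (lucky_word m P' \<beta>))"
    by (simp only: image_mset_Cons_comp[of _ "lucky_word (n + m) (occ \<union> (\<lambda>p. p + n) ` P')"])
  show ?case
    using left right by (simp add: c(2) lucky_word_Cons_parked[OF s(1-4)] image_mset.compositionality comp_def)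
qed

text \<open>Hall's bound at \<open>k = n + 1\<close> puts all preferences of \<alpha> within
  \<open>n\<close>, below the shifted ones. The alphabets are therefore disjoint, the shuffles have
  multiplicity 1, and the independence of the two families applies to an empty street.\<close>

lemma image_LW_shifted_shuffle:
  assumes "\<alpha> \<in> PF" "\<beta> \<in> PF"
  shows "image_mset LW (mset_set (shifted_shuffle \<alpha> \<beta>)) = shuffles_mset (LW \<alpha>) (LW \<beta>)"
proof -
  let ?n = "length \<alpha>" and ?m = "length \<beta>"
  let ?\<beta> = "map (\<lambda>b. b + ?n) \<beta>"
  have a: "parkable ?n {} \<alpha>" and b: "0 \<notin> set \<beta>"
    using assms by (simp_all add: PF_def parking_function_iff_parkable)
  have "a \<le> ?n" if "a \<in> set \<alpha>" for a
  proof (rule ccontr)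
    assume "\<not> a \<le> ?n"
    with that have "a \<in> set (filter (\<lambda>a. Suc ?n \<le> a) \<alpha>)" by simp
    moreover have "length (filter (\<lambda>a. Suc ?n \<le> a) \<alpha>) = 0"
      using a unfolding parkable_def by (metis add_is_0 diff_self_eq_0 le_zero_eq)
    ultimately show False by (metis length_0_conv list.set(1) empty_iff)
  qed
  with b have "set \<alpha> \<inter> set ?\<beta> = {}" by fastforce
  then have "mset_set (shifted_shuffle \<alpha> \<beta>) = shuffles_mset \<alpha> ?\<beta>"
    by (simp add: shifted_shuffle_def mset_set_shuffles)
  moreover have "LW \<gamma> = lucky_word (?n + ?m) {} \<gamma>" if "\<gamma> \<in> shifted_shuffle \<alpha> \<beta>" for \<gamma>
    using length_shuffles[of \<gamma> \<alpha> ?\<beta>] that by (simp add: LW_eq_lucky_word shifted_shuffle_def)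
  then have "image_mset LW (mset_set (shifted_shuffle \<alpha> \<beta>)) =
      image_mset (lucky_word (?n + ?m) {}) (mset_set (shifted_shuffle \<alpha> \<beta>))"
    by (intro image_mset_cong) (simp add: shifted_shuffle_def)
  ultimately show ?thesis
    using lucky_word_shuffles_mset[OF a _ _ b, of "{}" ?m] by (simp add: LW_eq_lucky_word)
qed

lemma image_LWr_shifted_shuffle:
  assumes "\<alpha> \<in> PF" "\<beta> \<in> PF"
  shows "image_mset LWr (mset_set (shifted_shuffle \<alpha> \<beta>)) = shuffles_mset (LWr \<alpha>) (LWr \<beta>)"
  using arg_cong[OF image_LW_shifted_shuffle[OF assms], of "image_mset rev"]
  by (simp add: LWr_def[abs_def] shuffles_mset_rev image_mset.compositionality comp_def)

section \<open>Lucky sets and the words they realize\<close>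

lemma length_LW [simp]: "length (LW \<alpha>) = length \<alpha>"
  by (simp add: LW_def del: upt_Suc)

lemma Lucky_eq_LW: "Lucky \<alpha> = {i \<in> {1..length (LW \<alpha>)}. LW \<alpha> ! (i - 1)}"
proof (rule Set.set_eqI)
  show "i \<in> Lucky \<alpha> \<longleftrightarrow> i \<in> {i \<in> {1..length (LW \<alpha>)}. LW \<alpha> ! (i - 1)}" for i
    by (cases i) (auto simp: LW_def Lucky_def simp del: upt_Suc)
qed

text \<open>A class of \<open>Lucky\<close> fixes the length as well as the lucky set, so classes
  amount to lucky words.\<close>

lemma LW_eq_iff: "LW \<alpha> = LW \<beta> \<longleftrightarrow> length \<alpha> = length \<beta> \<and> Lucky \<alpha> = Lucky \<beta>"
  by (metis LW_def Lucky_eq_LW length_LW)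

lemma weakly_shuffle_compatible_Lucky: "weakly_shuffle_compatible Lucky"
  unfolding weakly_shuffle_compatible_def
proof (intro ballI impI)
  fix \<alpha> \<beta> \<alpha>' \<beta>'
  assume h: "\<alpha> \<in> PF" "\<beta> \<in> PF" "\<alpha>' \<in> PF" "\<beta>' \<in> PF"
    and "length \<alpha> = length \<alpha>'" "length \<beta> = length \<beta>'" "Lucky \<alpha> = Lucky \<alpha>'" "Lucky \<beta> = Lucky \<beta>'"
  then have "LW \<alpha> = LW \<alpha>'" "LW \<beta> = LW \<beta>'" by (simp_all add: LW_eq_iff)
  then have "image_mset LW (mset_set (shifted_shuffle \<alpha> \<beta>)) =
      image_mset LW (mset_set (shifted_shuffle \<alpha>' \<beta>'))"
    using h by (simp add: image_LW_shifted_shuffle)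
  \<comment> \<open>\<open>Lucky\<close> factors through \<open>LW\<close>, so the equality of
    multisets of words passes to multisets of lucky sets.\<close>
  moreover have "image_mset Lucky M =
      image_mset (\<lambda>w. {i \<in> {1..length w}. w ! (i - 1)}) (image_mset LW M)" for M
    unfolding image_mset.compositionality comp_def Lucky_eq_LW[symmetric] ..
  ultimately show "image_mset Lucky (mset_set (shifted_shuffle \<alpha> \<beta>)) =
      image_mset Lucky (mset_set (shifted_shuffle \<alpha>' \<beta>'))"
    by simp
qed

text \<open>The first \<open>k\<close> cars occupy the spots \<open>1, \<dots>, k\<close>; the next one is lucky if it prefers \<open>k + 1\<close>
  and unlucky if it prefers \<open>1\<close>.\<close>

fun preferences_of_word :: "nat \<Rightarrow> bool list \<Rightarrow> nat list" where
  "preferences_of_word k [] = []"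
| "preferences_of_word k (b # w) = (if b then Suc k else 1) # preferences_of_word (Suc k) w"

lemma length_preferences_of_word [simp]: "length (preferences_of_word k w) = length w"
  by (induction w arbitrary: k) auto

text \<open>The assumption excludes an unlucky first car on an empty street: for
  \<open>k = 0\<close> the preference 1 is itself the free spot. After one car it holds
  automatically.\<close>

lemma lucky_word_preferences_of_word:
  assumes "w \<noteq> [] \<Longrightarrow> 0 < k \<or> hd w"
  shows "lucky_word (k + length w) {1..k} (preferences_of_word k w) = w"
  using assms
proof (induction w arbitrary: k)
  case (Cons b w)
  have "lucky_word (k + length (b # w)) {1..k} (preferences_of_word k (b # w)) =
      (Suc k = (if b then Suc k else 1)) #
        lucky_word (k + length (b # w)) (insert (Suc k) {1..k}) (preferences_of_word (Suc k) w)"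
    unfolding preferences_of_word.simps by (rule lucky_word_Cons_parked) auto
  moreover have "insert (Suc k) {1..k} = {1..Suc k}" by auto
  ultimately show ?case using Cons.IH[of "Suc k"] Cons.prems by auto
qed simp

text \<open>The induction undoes the parking of one car in spot \<open>k + 1\<close>. For
  \<open>j \<le> k + 1\<close> a taken spot disappears and at most one preference is added; for
  larger \<open>j\<close> the added preference is not counted. In the base case the whole street is
  taken.\<close>

lemma parkable_preferences_of_word:
  "parkable (k + length w) {1..k} (preferences_of_word k w)"
proof (induction w arbitrary: k)
  case Nil
  have "card ({1..k} \<inter> {j..k}) \<le> Suc k - j" for j
    using card_mono[of "{j..k}" "{1..k} \<inter> {j..k}"] by simp
  then show ?case by (simp add: parkable_def)
next
  case (Cons b w)
  let ?n = "k + length (b # w)"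
  have "card ({1..k} \<inter> {j..?n}) + length (filter (\<lambda>a. j \<le> a) (preferences_of_word k (b # w))) \<le> Suc ?n - j"
    for j
  proof -
    have IH: "card ({1..Suc k} \<inter> {j..?n}) + length (filter (\<lambda>a. j \<le> a) (preferences_of_word (Suc k) w))
        \<le> Suc ?n - j"
      using Cons[of "Suc k"] by (simp add: parkable_def)
    show ?thesis
    proof (cases "j \<le> Suc k")
      case True
      then have "{1..Suc k} \<inter> {j..?n} = insert (Suc k) ({1..k} \<inter> {j..?n})" by auto
      then have "card ({1..Suc k} \<inter> {j..?n}) = Suc (card ({1..k} \<inter> {j..?n}))"
        by (simp del: Int_atLeastAtMost)
      then show ?thesis using IH by (auto simp del: Int_atLeastAtMost)
    next
      case False
      then have "{1..Suc k} \<inter> {j..?n} = {1..k} \<inter> {j..?n}" by auto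
      then show ?thesis using IH False by (simp del: Int_atLeastAtMost)
    qed
  qed
  then show ?case by (simp add: parkable_def)
qed

text \<open>On an empty street nothing blocks the first car, so its spot \<open>s\<close> equals its
  preference.\<close>

lemma hd_LW:
  assumes "\<alpha> \<in> PF" "\<alpha> \<noteq> []"
  shows "hd (LW \<alpha>)"
proof -
  obtain a as where \<alpha>: "\<alpha> = a # as" using assms by (cases \<alpha>) auto
  have "parkable (length \<alpha>) {} (a # as)"
    using assms \<alpha> by (simp add: PF_def parking_function_iff_parkable)
  then obtain s where s: "a \<le> s" "s \<le> length \<alpha>" "{a..<s} \<subseteq> {}" by (rule parkable_Cons)
  then have "s = a" by auto
  then show ?thesis
    using s \<alpha> lucky_word_Cons_parked[of a a "length \<alpha>" "{}" as] by (simp add: LW_eq_lucky_word)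
qed

text \<open>The last letter of the reversed word belongs to the first car. The right-hand side is
  also the range of \<open>epsilon\<close>, so lucky words match compositions.\<close>

lemma image_LWr_PF: "LWr ` PF = {w. w \<noteq> [] \<longrightarrow> last w}"
proof (intro equalityI subsetI)
  fix w assume "w \<in> LWr ` PF"
  then show "w \<in> {w. w \<noteq> [] \<longrightarrow> last w}"
    using hd_LW by (auto simp: LWr_def last_rev) (metis length_LW length_0_conv)+
next
  fix w :: "bool list" assume w: "w \<in> {w. w \<noteq> [] \<longrightarrow> last w}"
  let ?\<alpha> = "preferences_of_word 0 (rev w)"
  have "0 \<notin> set (preferences_of_word k v)" for k v
    by (induction v arbitrary: k) auto
  then have "?\<alpha> \<in> PF"
    using parkable_preferences_of_word[of 0 "rev w"]
    by (simp add: PF_def parking_function_iff_parkable)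
  moreover have "LWr ?\<alpha> = w"
    using lucky_word_preferences_of_word[of "rev w" 0] w
    by (simp add: LWr_def LW_eq_lucky_word hd_rev)
  ultimately show "w \<in> LWr ` PF" by (metis imageI)
qed

section \<open>Linear extensions into quasisymmetric functions\<close>

text \<open>Each missing axiom is an equation whose two sides have equal images in \<open>B\<close>;
  injectivity of \<open>h\<close> cancels \<open>h\<close>. This spares a direct combinatorial check
  of associativity and commutativity for products of classes.\<close>

lemma algebra_if_inj_hom:
  fixes K (structure) and A and B
  assumes B: "algebra K B" and A: "Module.module K A"
    and mult_closed: "\<And>x y. x \<in> carrier A \<Longrightarrow> y \<in> carrier A \<Longrightarrow> x \<otimes>\<^bsub>A\<^esub> y \<in> carrier A"
    and one_closed: "\<one>\<^bsub>A\<^esub> \<in> carrier A"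
    and inj: "inj_on h (carrier A)"
    and ring_hom: "h \<in> Ring.ring_hom A B"
    and smult: "\<And>a x. a \<in> carrier K \<Longrightarrow> x \<in> carrier A \<Longrightarrow> h (a \<odot>\<^bsub>A\<^esub> x) = a \<odot>\<^bsub>B\<^esub> h x"
  shows "algebra K A"
proof -
  interpret B: algebra K B by (rule B)
  interpret A: Module.module K A by (rule A)
  note h = ring_hom_memE[OF ring_hom]
  note cancel = inj_onD[OF inj]
  have "cring A"
  proof (rule cringI)
    show "abelian_group A" ..
    show "comm_monoid A"
    proof (rule comm_monoidI)
      fix x y z assume "x \<in> carrier A" "y \<in> carrier A" "z \<in> carrier A"
      then show "x \<otimes>\<^bsub>A\<^esub> y \<otimes>\<^bsub>A\<^esub> z = x \<otimes>\<^bsub>A\<^esub> (y \<otimes>\<^bsub>A\<^esub> z)"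
        by (intro cancel) (simp_all add: h mult_closed B.m_assoc)
    next
      fix x y assume "x \<in> carrier A" "y \<in> carrier A"
      then show "x \<otimes>\<^bsub>A\<^esub> y = y \<otimes>\<^bsub>A\<^esub> x"
        by (intro cancel) (simp_all add: h mult_closed B.m_comm)
    next
      fix x assume "x \<in> carrier A"
      then show "\<one>\<^bsub>A\<^esub> \<otimes>\<^bsub>A\<^esub> x = x"
        by (intro cancel) (simp_all add: h mult_closed one_closed)
    qed (fact mult_closed one_closed)+
    fix x y z assume "x \<in> carrier A" "y \<in> carrier A" "z \<in> carrier A"
    then show "(x \<oplus>\<^bsub>A\<^esub> y) \<otimes>\<^bsub>A\<^esub> z = x \<otimes>\<^bsub>A\<^esub> z \<oplus>\<^bsub>A\<^esub> y \<otimes>\<^bsub>A\<^esub> z"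
      by (intro cancel) (simp_all add: h mult_closed B.l_distr)
  qed
  with B.R_cring show ?thesis
  proof (rule algebraI)
    fix a x y assume "a \<in> carrier K" "x \<in> carrier A" "y \<in> carrier A"
    then show "a \<odot>\<^bsub>A\<^esub> x \<otimes>\<^bsub>A\<^esub> y = a \<odot>\<^bsub>A\<^esub> (x \<otimes>\<^bsub>A\<^esub> y)"
      by (intro cancel) (simp_all add: h mult_closed smult B.smult_assoc2)
  qed (simp_all add: A.smult_l_distr A.smult_r_distr A.smult_assoc1)
qed

section \<open>Multiplication of power series and the algebra of quasisymmetric functions\<close>

lemma QSym_mult: "(f \<otimes>\<^bsub>QSym\<^esub> g) m = (\<Sum>(a, b)\<in>{(a, b). a + b = m}. f a * g b)"
  by (simp add: QSym_def)

lemma QSym_mult_commute: "f \<otimes>\<^bsub>QSym\<^esub> g = g \<otimes>\<^bsub>QSym\<^esub> f"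
  by (rule ext, unfold QSym_mult,
      rule sum.reindex_bij_witness[where i = prod.swap and j = prod.swap]) (auto simp: add.commute)

lemma QSym_mult_assoc: "(f \<otimes>\<^bsub>QSym\<^esub> g) \<otimes>\<^bsub>QSym\<^esub> h = f \<otimes>\<^bsub>QSym\<^esub> (g \<otimes>\<^bsub>QSym\<^esub> h)"
proof
  fix m :: "nat \<Rightarrow>\<^sub>0 nat"
  let ?S = "\<lambda>m :: nat \<Rightarrow>\<^sub>0 nat. {p. fst p + snd p = m}"
  have fin: "finite (?S m)" for m
    using finite_monomial_splittings[of m] by (simp add: case_prod_unfold)
  have mult: "(u \<otimes>\<^bsub>QSym\<^esub> v) m = (\<Sum>p\<in>?S m. u (fst p) * v (snd p))" for u v m
    by (simp add: QSym_mult case_prod_unfold)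
  have "((f \<otimes>\<^bsub>QSym\<^esub> g) \<otimes>\<^bsub>QSym\<^esub> h) m =
      (\<Sum>p\<in>?S m. \<Sum>q\<in>?S (fst p). f (fst q) * g (snd q) * h (snd p))"
    by (simp add: mult sum_distrib_right)
  also have "\<dots> = (\<Sum>(p, q)\<in>Sigma (?S m) (\<lambda>p. ?S (fst p)). f (fst q) * g (snd q) * h (snd p))"
    by (simp add: sum.Sigma fin)
  \<comment> \<open>Both index sets encode the ordered triples of monomials with sum
    \<open>m\<close>, bracketed to the left and to the right; the two witnesses rebracket.\<close>
  also have "\<dots> = (\<Sum>(p, q)\<in>Sigma (?S m) (\<lambda>p. ?S (snd p)). f (fst p) * (g (fst q) * h (snd q)))"
    by (rule sum.reindex_bij_witness[where
          j = "\<lambda>(p, q). ((fst q, snd q + snd p), (snd q, snd p))" and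
          i = "\<lambda>(p, q). ((fst p + fst q, snd q), (fst p, fst q))"])
      (auto simp: add.assoc)
  also have "\<dots> = (\<Sum>p\<in>?S m. \<Sum>q\<in>?S (snd p). f (fst p) * (g (fst q) * h (snd q)))"
    by (simp add: sum.Sigma fin)
  also have "\<dots> = (f \<otimes>\<^bsub>QSym\<^esub> (g \<otimes>\<^bsub>QSym\<^esub> h)) m"
    by (simp add: mult sum_distrib_left)
  finally show "((f \<otimes>\<^bsub>QSym\<^esub> g) \<otimes>\<^bsub>QSym\<^esub> h) m = (f \<otimes>\<^bsub>QSym\<^esub> (g \<otimes>\<^bsub>QSym\<^esub> h)) m" .
qed

lemma QSym_one_mult: "\<one>\<^bsub>QSym\<^esub> \<otimes>\<^bsub>QSym\<^esub> f = f"
proof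
  fix m
  have "(\<one>\<^bsub>QSym\<^esub> \<otimes>\<^bsub>QSym\<^esub> f) m =
      (\<Sum>(a, b)\<in>{(a, b). a + b = m}. (if a = 0 then 1 else 0) * f b)"
    by (simp add: QSym_def)
  also have "\<dots> = (\<Sum>(a, b)\<in>{(0 :: nat \<Rightarrow>\<^sub>0 nat, m)}. (if a = 0 then 1 else 0) * f b)"
    by (rule sum.mono_neutral_right) (auto simp: finite_monomial_splittings split: if_splits)
  finally show "(\<one>\<^bsub>QSym\<^esub> \<otimes>\<^bsub>QSym\<^esub> f) m = f m" by simp
qed

lemma QSym_sum_mult_sum:
  "((\<lambda>m. \<Sum>i\<in>I. u i m) \<otimes>\<^bsub>QSym\<^esub> (\<lambda>m. \<Sum>j\<in>J. v j m)) m = (\<Sum>i\<in>I. \<Sum>j\<in>J. (u i \<otimes>\<^bsub>QSym\<^esub> v j) m)"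
proof -
  let ?S = "{p :: (nat \<Rightarrow>\<^sub>0 nat) \<times> (nat \<Rightarrow>\<^sub>0 nat). fst p + snd p = m}"
  have "(\<Sum>p\<in>?S. \<Sum>i\<in>I. \<Sum>j\<in>J. u i (fst p) * v j (snd p)) =
      (\<Sum>i\<in>I. \<Sum>p\<in>?S. \<Sum>j\<in>J. u i (fst p) * v j (snd p))"
    by (rule sum.swap)
  also have "\<dots> = (\<Sum>i\<in>I. \<Sum>j\<in>J. \<Sum>p\<in>?S. u i (fst p) * v j (snd p))"
    by (rule sum.cong[OF refl], rule sum.swap)
  finally show ?thesis
    by (simp add: QSym_mult case_prod_unfold sum_product)
qed

lemma QSym_smult_mult_smult:
  "((\<lambda>m. a * f m) \<otimes>\<^bsub>QSym\<^esub> (\<lambda>m. b * g m)) m = a * b * (f \<otimes>\<^bsub>QSym\<^esub> g) m"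
  by (simp add: QSym_mult sum_distrib_left case_prod_unfold algebra_simps)

text \<open>Quasisymmetry compares monomials with the same positive exponents. Such a monomial is
  constant only if its exponent list is empty, whatever variables are used.\<close>

lemma QSym_one_closed: "\<one>\<^bsub>QSym\<^esub> \<in> carrier QSym"
proof -
  have "monomial_of ix as = 0 \<longleftrightarrow> as = []"
    if pos: "\<forall>a\<in>set as. 0 < a" and len: "length ix = length as" for ix as
  proof
    assume 0: "monomial_of ix as = 0"
    show "as = []"
    proof (rule ccontr)
      assume "as \<noteq> []"
      \<comment> \<open>The variable \<open>ix ! 0\<close> occurs with exponent at least
        \<open>as ! 0\<close>; equality would need distinct indices, which are not assumed
        here.\<close>
      then have "(0 :: nat) < as ! 0" using pos by simp
      also have "\<dots> = Poly_Mapping.lookup (Poly_Mapping.single (ix ! 0) (as ! 0)) (ix ! 0)" by simp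
      also have "\<dots> \<le> (\<Sum>l<length as. Poly_Mapping.lookup (Poly_Mapping.single (ix ! l) (as ! l)) (ix ! 0))"
        using \<open>as \<noteq> []\<close> by (intro member_le_sum) auto
      also have "\<dots> = 0"
        using arg_cong[OF 0, of "\<lambda>p. Poly_Mapping.lookup p (ix ! 0)"]
        by (simp add: monomial_of_def lookup_sum)
      finally show False by simp
    qed
  qed (simp add: monomial_of_def)
  then have "quasisymmetric \<one>\<^bsub>QSym\<^esub>"
    by (simp add: quasisymmetric_def QSym_def)
  moreover have "bounded_degree \<one>\<^bsub>QSym\<^esub>"
    unfolding bounded_degree_def by (rule exI[of _ 0]) (simp add: QSym_def)
  ultimately show ?thesis by (simp add: QSym_def)
qed

text \<open>Closure under multiplication is left as a hypothesis, to be discharged from a binary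
  shuffle basis. The multiplicative identities are those of formal power series.\<close>

lemma algebra_QSym:
  assumes closed: "\<And>f g. f \<in> carrier QSym \<Longrightarrow> g \<in> carrier QSym \<Longrightarrow> f \<otimes>\<^bsub>QSym\<^esub> g \<in> carrier QSym"
  shows "algebra (class_ring :: rat ring) QSym"
proof -
  interpret vectorspace "class_ring :: rat ring" QSym by (rule vectorspace_QSym)
  have "cring QSym"
  proof (rule cringI)
    show "abelian_group QSym" ..
    show "comm_monoid QSym"
      by (rule comm_monoidI)
        (auto simp: closed QSym_one_closed QSym_mult_assoc QSym_one_mult intro: QSym_mult_commute)
    show "(f \<oplus>\<^bsub>QSym\<^esub> g) \<otimes>\<^bsub>QSym\<^esub> h = f \<otimes>\<^bsub>QSym\<^esub> h \<oplus>\<^bsub>QSym\<^esub> g \<otimes>\<^bsub>QSym\<^esub> h" for f g h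
      by (simp add: QSym_def fun_eq_iff case_prod_unfold distrib_right sum.distrib)
  qed
  with fieldE(1)[OF class_field] show ?thesis
  proof (rule algebraI)
    show "c \<odot>\<^bsub>QSym\<^esub> f \<otimes>\<^bsub>QSym\<^esub> g = c \<odot>\<^bsub>QSym\<^esub> (f \<otimes>\<^bsub>QSym\<^esub> g)" for c f g
      by (simp add: QSym_def fun_eq_iff case_prod_unfold sum_distrib_left mult.assoc)
    show "\<one>\<^bsub>class_ring\<^esub> \<odot>\<^bsub>QSym\<^esub> f = f" if "f \<in> carrier QSym" for f
      using smult_one[OF that] .
    show "(a \<oplus>\<^bsub>class_ring\<^esub> b) \<odot>\<^bsub>QSym\<^esub> f = a \<odot>\<^bsub>QSym\<^esub> f \<oplus>\<^bsub>QSym\<^esub> b \<odot>\<^bsub>QSym\<^esub> f"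
      and "(a \<otimes>\<^bsub>class_ring\<^esub> b) \<odot>\<^bsub>QSym\<^esub> f = a \<odot>\<^bsub>QSym\<^esub> (b \<odot>\<^bsub>QSym\<^esub> f)"
      if "f \<in> carrier QSym" for a b f
      using that by (simp_all add: QSym_def distrib_right mult.assoc)
  qed (simp_all add: smult_r_distr)
qed

section \<open>Linear extension along a basis\<close>

lemma QSym_lincomb:
  assumes "finite A" "A \<subseteq> carrier QSym"
  shows "module.lincomb QSym c A = (\<lambda>m. \<Sum>v\<in>A. c v * v m)"
proof -
  interpret vectorspace "class_ring :: rat ring" QSym by (rule vectorspace_QSym)
  show ?thesis
    using assms
  proof (induction A rule: finite_induct)
    case empty
    then show ?case by (simp add: lincomb_def) (simp add: QSym_def)
  next
    case (insert v A)
    have "(\<Oplus>\<^bsub>QSym\<^esub>w\<in>insert v A. c w \<odot>\<^bsub>QSym\<^esub> w) =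
        c v \<odot>\<^bsub>QSym\<^esub> v \<oplus>\<^bsub>QSym\<^esub> (\<Oplus>\<^bsub>QSym\<^esub>w\<in>A. c w \<odot>\<^bsub>QSym\<^esub> w)"
      using insert by (intro finsum_insert) auto
    also have "\<dots> = (\<lambda>m. c v * v m + (\<Sum>w\<in>A. c w * w m))"
      using insert by (simp add: lincomb_def) (simp add: QSym_def)
    finally show ?case using insert by (simp add: lincomb_def)
  qed
qed

definition linear_extension ::
  "('c \<Rightarrow> series) \<Rightarrow> ('c \<Rightarrow>\<^sub>0 rat) \<Rightarrow> series" where
  "linear_extension z f = (\<lambda>m. \<Sum>C\<in>Poly_Mapping.keys f. Poly_Mapping.lookup f C * z C m)"

text \<open>Coefficients vanish off the support, so combinations with different supports can be
  compared over one common index set.\<close>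

lemma linear_extension_superset:
  assumes "finite S" "Poly_Mapping.keys f \<subseteq> S"
  shows "linear_extension z f m = (\<Sum>C\<in>S. Poly_Mapping.lookup f C * z C m)"
  unfolding linear_extension_def
  by (rule sum.mono_neutral_left) (use assms in \<open>auto simp: in_keys_iff\<close>)

lemma linear_extension_add:
  "linear_extension z (f + g) m = linear_extension z f m + linear_extension z g m"
proof -
  let ?S = "Poly_Mapping.keys f \<union> Poly_Mapping.keys g"
  show ?thesis
    using keys_add[of f g]
    by (simp add: linear_extension_superset[of ?S] lookup_add distrib_right sum.distrib)
qed

lemma linear_extension_zero [simp]: "linear_extension z 0 m = 0"
  by (simp add: linear_extension_def)

lemma linear_extension_sum:
  "linear_extension z (\<Sum>i\<in>I. f i) m = (\<Sum>i\<in>I. linear_extension z (f i) m)"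
  by (induction I rule: infinite_finite_induct) (simp_all add: linear_extension_add)

lemma linear_extension_single: "linear_extension z (Poly_Mapping.single C c) m = c * z C m"
  by (simp add: linear_extension_def)

lemma lookup_map_mult:
  "Poly_Mapping.lookup (Poly_Mapping.map ((*) (c :: 'a :: mult_zero)) f) C = c * Poly_Mapping.lookup f C"
  by (simp add: Poly_Mapping.map.rep_eq when_def)

lemma keys_map_subset: "Poly_Mapping.keys (Poly_Mapping.map g f) \<subseteq> Poly_Mapping.keys f"
  by (auto simp: in_keys_iff Poly_Mapping.map.rep_eq when_def)

lemma linear_extension_smult:
  "linear_extension z (Poly_Mapping.map ((*) c) f) m = c * linear_extension z f m"
  by (simp add: linear_extension_superset[OF finite_keys keys_map_subset] lookup_map_mult
      sum_distrib_left mult.assoc) (simp add: linear_extension_def sum_distrib_left mult.assoc)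

text \<open>Linear independence of \<open>B\<close> yields a trivial kernel and hence injectivity;
  spanning yields surjectivity.\<close>

lemma bij_betw_linear_extension:
  assumes basis: "vectorspace.basis (class_ring :: rat ring) QSym B" and z: "bij_betw z \<C> B"
  shows "bij_betw (linear_extension z) {f. Poly_Mapping.keys f \<subseteq> \<C>} (carrier QSym)"
proof -
  interpret vectorspace "class_ring :: rat ring" QSym by (rule vectorspace_QSym)
  have B: "lin_indpt B" "span B = carrier QSym" "B \<subseteq> carrier QSym"
    using basis by (simp_all add: basis_def)
  have inj: "inj_on z \<C>" and img: "z ` \<C> = B" using z by (simp_all add: bij_betw_def)
  define i where "i = inv_into \<C> z"
  \<comment> \<open>The inverse \<open>i\<close> of \<open>z\<close> reads coefficients off basis
    vectors, which turns the pointwise sum into a \<open>lincomb\<close> over vectors of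
    \<open>B\<close>.\<close>
  have lc: "linear_extension z f = lincomb (\<lambda>v. Poly_Mapping.lookup f (i v)) (z ` S)"
    if "finite S" "Poly_Mapping.keys f \<subseteq> S" "S \<subseteq> \<C>" for f S
  proof
    fix m
    have "z ` S \<subseteq> carrier QSym" using that img B by blast
    then have "lincomb (\<lambda>v. Poly_Mapping.lookup f (i v)) (z ` S) m =
        (\<Sum>v\<in>z ` S. Poly_Mapping.lookup f (i v) * v m)"
      using that by (simp add: QSym_lincomb)
    also have "\<dots> = (\<Sum>C\<in>S. Poly_Mapping.lookup f (i (z C)) * z C m)"
      using inj_on_subset[OF inj that(3)] by (simp add: sum.reindex)
    also have "\<dots> = (\<Sum>C\<in>S. Poly_Mapping.lookup f C * z C m)"
      using that inj by (intro sum.cong) (auto simp: i_def inv_into_f_f subset_iff)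
    also have "\<dots> = linear_extension z f m"
      using that by (simp add: linear_extension_superset)
    finally show "linear_extension z f m = lincomb (\<lambda>v. Poly_Mapping.lookup f (i v)) (z ` S) m" ..
  qed
  have kernel: "f = 0" if f: "Poly_Mapping.keys f \<subseteq> \<C>" and 0: "linear_extension z f = \<zero>\<^bsub>QSym\<^esub>" for f
  proof (rule ccontr)
    assume "f \<noteq> 0"
    then obtain C where C: "C \<in> Poly_Mapping.keys f" by (auto simp: keys_eq_empty[symmetric] simp del: keys_eq_empty)
    have "lin_dep B"
      unfolding lin_dep_def
    proof (intro exI conjI)
      show "lincomb (\<lambda>v. Poly_Mapping.lookup f (i v)) (z ` Poly_Mapping.keys f) = \<zero>\<^bsub>QSym\<^esub>"
        using lc[of "Poly_Mapping.keys f" f] f 0 by simp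
      show "z ` Poly_Mapping.keys f \<subseteq> B" using f img by blast
      show "z C \<in> z ` Poly_Mapping.keys f" using C by blast
      show "Poly_Mapping.lookup f (i (z C)) \<noteq> \<zero>\<^bsub>class_ring\<^esub>"
        using C f inj by (auto simp: i_def inv_into_f_f subset_iff in_keys_iff)
    qed auto
    with B(1) show False by simp
  qed
  have "inj_on (linear_extension z) {f. Poly_Mapping.keys f \<subseteq> \<C>}"
  proof (rule inj_onI)
    fix f g assume h: "f \<in> {f. Poly_Mapping.keys f \<subseteq> \<C>}" "g \<in> {f. Poly_Mapping.keys f \<subseteq> \<C>}"
      "linear_extension z f = linear_extension z g"
    have "linear_extension z (f - g) m = 0" for m
      using linear_extension_add[of z "f - g" g m] h(3) by simp
    moreover have "Poly_Mapping.keys (f - g) \<subseteq> \<C>"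
      using h keys_diff[of f g] by blast
    ultimately have "f - g = 0"
      by (intro kernel) (simp_all add: QSym_def fun_eq_iff)
    then show "f = g" by simp
  qed
  moreover have "linear_extension z f \<in> carrier QSym" if f: "Poly_Mapping.keys f \<subseteq> \<C>" for f
  proof -
    have "linear_extension z f = lincomb (\<lambda>v. Poly_Mapping.lookup f (i v)) (z ` Poly_Mapping.keys f)"
      using f by (intro lc) auto
    also have "\<dots> \<in> carrier QSym"
      using f img B by (intro lincomb_closed) auto
    finally show ?thesis .
  qed
  moreover have "\<exists>f. Poly_Mapping.keys f \<subseteq> \<C> \<and> linear_extension z f = v" if v: "v \<in> carrier QSym" for v
  proof -
    from v have "v \<in> span B" by (simp add: B)
    then obtain c A where A: "finite A" "A \<subseteq> B" "v = lincomb c A"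
      unfolding span_def by blast
    \<comment> \<open>A representation of \<open>v\<close> by basis vectors is pulled back to the
      index set along \<open>i\<close>.\<close>
    define S where "S = i ` A"
    have S: "finite S" "S \<subseteq> \<C>" "z ` S = A"
      using A img by (auto simp: S_def i_def inv_into_into f_inv_into_f image_iff subset_iff)
    define f where "f = (\<Sum>C\<in>S. Poly_Mapping.single C (c (z C)))"
    have "Poly_Mapping.keys f \<subseteq> S"
      unfolding f_def using keys_sum[of "\<lambda>C. Poly_Mapping.single C (c (z C))" S]
      by (auto split: if_splits)
    moreover have "linear_extension z f = v"
    proof
      fix m
      have "linear_extension z f m = (\<Sum>C\<in>S. c (z C) * z C m)"
        by (simp add: f_def linear_extension_sum linear_extension_single)
      also have "\<dots> = (\<Sum>w\<in>A. c w * w m)"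
        using inj_on_subset[OF inj S(2)] by (simp add: sum.reindex flip: S(3))
      also have "\<dots> = v m"
        using A B by (simp add: QSym_lincomb subset_trans)
      finally show "linear_extension z f m = v m" .
    qed
    ultimately show ?thesis using S by blast
  qed
  ultimately show ?thesis by (auto simp: bij_betw_def image_iff)
qed

section \<open>The algebra of lucky car sets\<close>

lemma module_PF_algebra: "Module.module (class_ring :: rat ring) (PF_algebra st)"
proof (rule moduleI)
  show "cring (class_ring :: rat ring)"
    using class_field by (rule fieldE(1))
  show "abelian_group (PF_algebra st)"
  proof (rule abelian_groupI)
    fix f g assume "f \<in> carrier (PF_algebra st)" "g \<in> carrier (PF_algebra st)"
    then show "f \<oplus>\<^bsub>PF_algebra st\<^esub> g \<in> carrier (PF_algebra st)"
      using keys_add[of f g] by (auto simp: PF_algebra_def)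
  next
    fix f assume "f \<in> carrier (PF_algebra st)"
    then show "\<exists>g\<in>carrier (PF_algebra st). g \<oplus>\<^bsub>PF_algebra st\<^esub> f = \<zero>\<^bsub>PF_algebra st\<^esub>"
      by (intro bexI[of _ "- f"]) (auto simp: PF_algebra_def)
  qed (auto simp: PF_algebra_def add_ac)
  fix c f assume "f \<in> carrier (PF_algebra st)"
  then show "c \<odot>\<^bsub>PF_algebra st\<^esub> f \<in> carrier (PF_algebra st)"
    using keys_map_subset[of "(*) c" f] by (auto simp: PF_algebra_def)
qed (auto simp: PF_algebra_def poly_mapping_eq_iff fun_eq_iff lookup_map_mult lookup_add algebra_simps)

lemma SOME_pf_class:
  assumes "\<alpha> \<in> PF"
  shows "(SOME \<beta>. \<beta> \<in> pf_class st \<alpha>) \<in> pf_class st \<alpha>"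
  by (rule someI[of _ \<alpha>]) (use assms in \<open>simp add: pf_class_def\<close>)

lemma SOME_class_PF:
  assumes "C \<in> pf_class st ` PF"
  shows "(SOME \<alpha>. \<alpha> \<in> C) \<in> PF"
proof -
  from assms obtain \<alpha> where "\<alpha> \<in> PF" "C = pf_class st \<alpha>" by blast
  then have "(SOME \<alpha>. \<alpha> \<in> C) \<in> pf_class st \<alpha>" using SOME_pf_class by simp
  then show ?thesis by (simp add: pf_class_def)
qed

text \<open>Chosen representatives are parking functions, and so are their shifted shuffles;
  products thus involve only genuine classes.\<close>

lemma keys_class_mult:
  assumes "C \<in> pf_class st ` PF" "D \<in> pf_class st ` PF"
  shows "Poly_Mapping.keys (class_mult st C D) \<subseteq> pf_class st ` PF"
proof -
  have "shifted_shuffle (SOME \<alpha>. \<alpha> \<in> C) (SOME \<beta>. \<beta> \<in> D) \<subseteq> PF"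
    using shifted_shuffle_PF[OF assms[THEN SOME_class_PF]] by blast
  then have "Poly_Mapping.keys (class_mult st C D) \<subseteq>
      (\<Union>\<gamma>\<in>PF. Poly_Mapping.keys (Poly_Mapping.single (pf_class st \<gamma>) (1 :: rat)))"
    unfolding class_mult_def by (intro order_trans[OF keys_sum]) blast
  then show ?thesis by auto
qed

lemma PF_algebra_mult_closed:
  assumes "f \<in> carrier (PF_algebra st)" "g \<in> carrier (PF_algebra st)"
  shows "f \<otimes>\<^bsub>PF_algebra st\<^esub> g \<in> carrier (PF_algebra st)"
proof -
  have "Poly_Mapping.keys (Poly_Mapping.map ((*) c) (class_mult st C D)) \<subseteq> pf_class st ` PF"
    if "C \<in> Poly_Mapping.keys f" "D \<in> Poly_Mapping.keys g" for c C D
    using that assms keys_class_mult[of C st D]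
    by (intro order_trans[OF keys_map_subset]) (auto simp: PF_algebra_def)
  then have "Poly_Mapping.keys (\<Sum>C\<in>Poly_Mapping.keys f. \<Sum>D\<in>Poly_Mapping.keys g.
      Poly_Mapping.map ((*) (c C D)) (class_mult st C D)) \<subseteq> pf_class st ` PF" for c
    by (intro order_trans[OF keys_sum] UN_least)
  then show ?thesis by (simp add: PF_algebra_def)
qed

text \<open>Meaningful on classes only, where it does not depend on the chosen representative.\<close>

definition class_word :: "nat list set \<Rightarrow> bool list" where
  "class_word C = LWr (SOME \<alpha>. \<alpha> \<in> C)"

text \<open>All members of a class share length and lucky set, hence their lucky word.\<close>

lemma class_word_pf_class:
  assumes "\<alpha> \<in> PF"
  shows "class_word (pf_class Lucky \<alpha>) = LWr \<alpha>"
  using SOME_pf_class[OF assms, of Lucky] LW_eq_iff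
  by (auto simp: class_word_def pf_class_def LWr_def)

lemma bij_betw_class_word: "bij_betw class_word (pf_class Lucky ` PF) {w. w \<noteq> [] \<longrightarrow> last w}"
proof -
  have "inj_on class_word (pf_class Lucky ` PF)"
  proof (rule inj_onI)
    fix C D
    assume "C \<in> pf_class Lucky ` PF" "D \<in> pf_class Lucky ` PF" and eq: "class_word C = class_word D"
    then obtain \<alpha> \<beta> where h: "\<alpha> \<in> PF" "C = pf_class Lucky \<alpha>" "\<beta> \<in> PF" "D = pf_class Lucky \<beta>"
      by blast
    with eq have "LW \<alpha> = LW \<beta>" by (simp add: class_word_pf_class LWr_def)
    with h show "C = D" by (simp add: LW_eq_iff pf_class_def)
  qed
  moreover have "class_word ` pf_class Lucky ` PF = LWr ` PF"
    by (simp add: image_image class_word_pf_class)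
  ultimately show ?thesis by (simp add: bij_betw_def image_LWr_PF)
qed

section \<open>The isomorphism determined by a binary shuffle basis\<close>

context
  fixes Z :: "nat list \<Rightarrow> series"
  assumes Z: "binary_shuffle_basis Z"
begin

definition class_to_QSym :: "nat list set \<Rightarrow> series" where
  "class_to_QSym C = Z (epsilon_inv (class_word C))"

lemma epsilon_inv_in: "w \<noteq> [] \<longrightarrow> last w \<Longrightarrow> epsilon_inv w \<in> compositions"
  using bij_betw_inv_into[OF bij_betw_epsilon] by (auto simp: epsilon_inv_def bij_betw_def)

lemma epsilon_epsilon_inv: "w \<noteq> [] \<longrightarrow> last w \<Longrightarrow> epsilon (epsilon_inv w) = w"
  using bij_betw_inv_into_right[OF bij_betw_epsilon] by (simp add: epsilon_inv_def)

text \<open>Three bijections are composed: classes to words, words to compositions, compositions to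
  basis elements.\<close>

lemma bij_betw_class_to_QSym: "bij_betw class_to_QSym (pf_class Lucky ` PF) (Z ` compositions)"
proof -
  have "bij_betw Z compositions (Z ` compositions)"
    using Z by (simp add: binary_shuffle_basis_def inj_on_imp_bij_betw)
  from bij_betw_trans[OF bij_betw_trans[OF bij_betw_class_word
        bij_betw_inv_into[OF bij_betw_epsilon]] this]
  show ?thesis
    by (simp only: class_to_QSym_def[abs_def] epsilon_inv_def comp_def)
qed

text \<open>Both sides become the sum over interleavings of two reversed lucky words.
  \<open>class_mult\<close> and \<open>class_word\<close> choose the same representatives, so none
  has to be exchanged.\<close>

lemma linear_extension_class_mult:
  assumes "C \<in> pf_class Lucky ` PF" "D \<in> pf_class Lucky ` PF"
  shows "linear_extension class_to_QSym (class_mult Lucky C D) m =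
    (class_to_QSym C \<otimes>\<^bsub>QSym\<^esub> class_to_QSym D) m"
proof -
  define \<alpha> where "\<alpha> = (SOME \<alpha>. \<alpha> \<in> C)"
  define \<beta> where "\<beta> = (SOME \<beta>. \<beta> \<in> D)"
  have \<alpha>: "\<alpha> \<in> PF" and \<beta>: "\<beta> \<in> PF"
    unfolding \<alpha>_def \<beta>_def by (rule assms[THEN SOME_class_PF])+
  \<comment> \<open>Reversed lucky words lie in the range of \<open>epsilon\<close>, so
    \<open>epsilon_inv\<close> truly inverts it on them.\<close>
  have w: "LWr \<gamma> \<noteq> [] \<longrightarrow> last (LWr \<gamma>)" if "\<gamma> \<in> PF" for \<gamma>
    using that image_LWr_PF by blast
  have "linear_extension class_to_QSym (class_mult Lucky C D) m =
      (\<Sum>\<gamma>\<in>shifted_shuffle \<alpha> \<beta>. class_to_QSym (pf_class Lucky \<gamma>) m)"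
    by (simp add: class_mult_def linear_extension_sum linear_extension_single flip: \<alpha>_def \<beta>_def)
  also have "\<dots> = (\<Sum>\<gamma>\<in>shifted_shuffle \<alpha> \<beta>. Z (epsilon_inv (LWr \<gamma>)) m)"
    using shifted_shuffle_PF[OF \<alpha> \<beta>]
    by (intro sum.cong) (simp_all add: class_to_QSym_def class_word_pf_class)
  also have "\<dots> = (\<Sum>w\<in>#image_mset LWr (mset_set (shifted_shuffle \<alpha> \<beta>)). Z (epsilon_inv w) m)"
    by (simp add: sum_unfold_sum_mset image_mset.compositionality comp_def)
  also have "\<dots> = (\<Sum>w\<in>#shuffles_mset (LWr \<alpha>) (LWr \<beta>). Z (epsilon_inv w) m)"
    using \<alpha> \<beta> by (simp add: image_LWr_shifted_shuffle)
  also have "\<dots> = (Z (epsilon_inv (LWr \<alpha>)) \<otimes>\<^bsub>QSym\<^esub> Z (epsilon_inv (LWr \<beta>))) m"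
    using Z w[OF \<alpha>] w[OF \<beta>]
    by (simp add: binary_shuffle_basis_def epsilon_inv_in epsilon_epsilon_inv)
  finally show ?thesis
    by (simp add: class_to_QSym_def class_word_def flip: \<alpha>_def \<beta>_def)
qed

lemma linear_extension_PF_algebra_mult:
  assumes "f \<in> carrier (PF_algebra Lucky)" "g \<in> carrier (PF_algebra Lucky)"
  shows "linear_extension class_to_QSym (f \<otimes>\<^bsub>PF_algebra Lucky\<^esub> g) =
    linear_extension class_to_QSym f \<otimes>\<^bsub>QSym\<^esub> linear_extension class_to_QSym g"
proof
  fix m
  have "linear_extension class_to_QSym (f \<otimes>\<^bsub>PF_algebra Lucky\<^esub> g) m =
      (\<Sum>C\<in>Poly_Mapping.keys f. \<Sum>D\<in>Poly_Mapping.keys g.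
        Poly_Mapping.lookup f C * Poly_Mapping.lookup g D *
          linear_extension class_to_QSym (class_mult Lucky C D) m)"
    by (simp add: PF_algebra_def linear_extension_sum linear_extension_smult)
  also have "\<dots> = (\<Sum>C\<in>Poly_Mapping.keys f. \<Sum>D\<in>Poly_Mapping.keys g.
        Poly_Mapping.lookup f C * Poly_Mapping.lookup g D *
          (class_to_QSym C \<otimes>\<^bsub>QSym\<^esub> class_to_QSym D) m)"
    using assms by (intro sum.cong refl arg_cong[where f = "(*) _"] linear_extension_class_mult)
      (auto simp: PF_algebra_def)
  also have "\<dots> = (linear_extension class_to_QSym f \<otimes>\<^bsub>QSym\<^esub> linear_extension class_to_QSym g) m"
    unfolding linear_extension_def by (simp add: QSym_sum_mult_sum QSym_smult_mult_smult)
  finally show "linear_extension class_to_QSym (f \<otimes>\<^bsub>PF_algebra Lucky\<^esub> g) m =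
    (linear_extension class_to_QSym f \<otimes>\<^bsub>QSym\<^esub> linear_extension class_to_QSym g) m" .
qed

lemma bij_betw_linear_extension_PF_algebra:
  "bij_betw (linear_extension class_to_QSym) (carrier (PF_algebra Lucky)) (carrier QSym)"
  using bij_betw_linear_extension[OF _ bij_betw_class_to_QSym] Z
  by (simp add: binary_shuffle_basis_def PF_algebra_def)

text \<open>The empty word has a single interleaving with any word, so \<open>Z []\<close> fixes
  every basis element. By linearity it fixes the unit of \<open>QSym\<close>, and is therefore equal
  to it.\<close>

lemma Z_Nil: "Z [] = \<one>\<^bsub>QSym\<^esub>"
proof -
  have unit: "(Z [] \<otimes>\<^bsub>QSym\<^esub> Z \<delta>) m = Z \<delta> m" if "\<delta> \<in> compositions" for \<delta> m
  proof -
    have "epsilon_inv (epsilon \<delta>) = \<delta>"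
      using that bij_betw_epsilon by (simp add: epsilon_inv_def bij_betw_def inv_into_f_f)
    moreover have "[] \<in> compositions" by (simp add: compositions_def)
    ultimately show ?thesis
      using Z that by (simp add: binary_shuffle_basis_def epsilon_Nil)
  qed
  have unit': "(Z [] \<otimes>\<^bsub>QSym\<^esub> class_to_QSym C) m = class_to_QSym C m"
    if "C \<in> pf_class Lucky ` PF" for C m
  proof -
    have "class_to_QSym C \<in> Z ` compositions"
      using bij_betw_class_to_QSym that by (rule bij_betwE[rule_format])
    then show ?thesis using unit by fastforce
  qed
  obtain f where "f \<in> carrier (PF_algebra Lucky)" and
    one: "\<one>\<^bsub>QSym\<^esub> = linear_extension class_to_QSym f"
    using bij_betw_imp_surj_on[OF bij_betw_linear_extension_PF_algebra] QSym_one_closed by blast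
  then have f: "Poly_Mapping.keys f \<subseteq> pf_class Lucky ` PF" by (simp add: PF_algebra_def)
  have "(Z [] \<otimes>\<^bsub>QSym\<^esub> linear_extension class_to_QSym f) m = linear_extension class_to_QSym f m" for m
  proof -
    \<comment> \<open>A one-element sum with coefficient 1 brings \<open>Z []\<close> into the shape
      required by bilinearity.\<close>
    have "(Z [] \<otimes>\<^bsub>QSym\<^esub> linear_extension class_to_QSym f) m =
        ((\<lambda>m. \<Sum>i\<in>{()}. 1 * Z [] m) \<otimes>\<^bsub>QSym\<^esub> linear_extension class_to_QSym f) m"
      by simp
    also have "\<dots> = (\<Sum>C\<in>Poly_Mapping.keys f. Poly_Mapping.lookup f C * (Z [] \<otimes>\<^bsub>QSym\<^esub> class_to_QSym C) m)"
      unfolding linear_extension_def QSym_sum_mult_sum QSym_smult_mult_smult by simp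
    also have "\<dots> = linear_extension class_to_QSym f m"
      unfolding linear_extension_def by (rule sum.cong) (use f unit' in auto)
    finally show ?thesis .
  qed
  then have "Z [] \<otimes>\<^bsub>QSym\<^esub> \<one>\<^bsub>QSym\<^esub> = \<one>\<^bsub>QSym\<^esub>"
    unfolding one by (rule ext)
  then show ?thesis by (metis QSym_mult_commute QSym_one_mult)
qed

lemma algebra_isomorphism_linear_extension:
  "algebra_isomorphism (class_ring :: rat ring) (PF_algebra Lucky) QSym (linear_extension class_to_QSym)"
proof -
  let ?A = "PF_algebra Lucky" and ?\<phi> = "linear_extension class_to_QSym"
  have closed: "?\<phi> f \<in> carrier QSym" if "f \<in> carrier ?A" for f
    using bij_betw_linear_extension_PF_algebra that by (rule bij_betwE[rule_format])
  have add: "?\<phi> (f \<oplus>\<^bsub>?A\<^esub> g) = ?\<phi> f \<oplus>\<^bsub>QSym\<^esub> ?\<phi> g" for f g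
    by (simp add: PF_algebra_def QSym_def fun_eq_iff linear_extension_add)
  have smult: "?\<phi> (c \<odot>\<^bsub>?A\<^esub> f) = c \<odot>\<^bsub>QSym\<^esub> ?\<phi> f" for c f
    by (simp add: PF_algebra_def QSym_def fun_eq_iff linear_extension_smult)
  have Nil: "[] \<in> PF" by (simp add: PF_def parking_function_def)
  have "LWr [] = []" by (simp add: LWr_def LW_def)
  moreover have "epsilon_inv [] = []"
    using epsilon_epsilon_inv[of "[]"] bij_betw_epsilon epsilon_inv_in[of "[]"]
    by (auto simp: bij_betw_def inj_on_def compositions_def epsilon_Nil)
  ultimately have one: "?\<phi> \<one>\<^bsub>?A\<^esub> = \<one>\<^bsub>QSym\<^esub>"
    by (simp add: PF_algebra_def fun_eq_iff linear_extension_single class_to_QSym_def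
        class_word_pf_class[OF Nil] Z_Nil)
  have hom: "?\<phi> \<in> Ring.ring_hom ?A QSym"
    by (rule ring_hom_memI) (simp_all add: closed add one linear_extension_PF_algebra_mult)
  \<comment> \<open>By surjectivity two elements of \<open>QSym\<close> are images, and their
    product is the image of a product; this supplies the missing closure.\<close>
  have "algebra (class_ring :: rat ring) QSym"
  proof (rule algebra_QSym)
    fix u v assume "u \<in> carrier QSym" "v \<in> carrier QSym"
    then obtain f g where "f \<in> carrier ?A" "u = ?\<phi> f" "g \<in> carrier ?A" "v = ?\<phi> g"
      using bij_betw_imp_surj_on[OF bij_betw_linear_extension_PF_algebra] by blast
    then show "u \<otimes>\<^bsub>QSym\<^esub> v \<in> carrier QSym"
      using closed[OF PF_algebra_mult_closed[of f Lucky g]]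
      by (simp add: linear_extension_PF_algebra_mult)
  qed
  \<comment> \<open>The axioms now travel back from \<open>QSym\<close> along the injective
    map.\<close>
  moreover have "algebra (class_ring :: rat ring) ?A"
  proof (rule algebra_if_inj_hom[OF calculation module_PF_algebra _ _ _ hom])
    show "\<one>\<^bsub>?A\<^esub> \<in> carrier ?A" using Nil by (simp add: PF_algebra_def)
    show "inj_on ?\<phi> (carrier ?A)"
      using bij_betw_linear_extension_PF_algebra by (rule bij_betw_imp_inj_on)
  qed (rule PF_algebra_mult_closed smult | assumption)+
  moreover have "?\<phi> \<in> LinearCombinations.module_hom class_ring ?A QSym"
    by (simp add: LinearCombinations.module_hom_def closed add smult)
  moreover have "?\<phi> \<in> ring_iso ?A QSym"
    using hom bij_betw_linear_extension_PF_algebra by (simp add: ring_iso_def)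
  ultimately show ?thesis by (simp add: algebra_isomorphism_def)
qed

end

theorem theorem4p12:
  shows "weakly_shuffle_compatible Lucky \<and>
    (\<forall>Z. binary_shuffle_basis Z \<longrightarrow>
       (\<exists>\<phi>. algebra_isomorphism (class_ring :: rat ring) (PF_algebra Lucky) QSym \<phi> \<and>
            (\<forall>\<alpha>\<in>PF. \<phi> (Poly_Mapping.single (pf_class Lucky \<alpha>) 1) = Z (epsilon_inv (LWr \<alpha>)))))"
proof (intro conjI allI impI)
  fix Z assume Z: "binary_shuffle_basis Z"
  have "linear_extension (class_to_QSym Z) (Poly_Mapping.single (pf_class Lucky \<alpha>) 1) =
      Z (epsilon_inv (LWr \<alpha>))" if "\<alpha> \<in> PF" for \<alpha>
    using that by (simp add: fun_eq_iff linear_extension_single class_to_QSym_def[OF Z] class_word_pf_class)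
  with algebra_isomorphism_linear_extension[OF Z]
  show "\<exists>\<phi>. algebra_isomorphism (class_ring :: rat ring) (PF_algebra Lucky) QSym \<phi> \<and>
      (\<forall>\<alpha>\<in>PF. \<phi> (Poly_Mapping.single (pf_class Lucky \<alpha>) 1) = Z (epsilon_inv (LWr \<alpha>)))"
    by blast
qed (rule weakly_shuffle_compatible_Lucky)

end
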